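(* For the $(N,K)$ demand-private coded caching system with Single File Retrieval demands described in the context, let $R_{\mathrm{F}}(M)$, $M\in[0,N]$, be the lower convex envelope of the points $\{(0,N)\}\cup\{(M_t,R_t):t\in\{0,\ldots,K\}\}$, where $$(M_t,R_t)=\left(1+\frac{t(N-1)}{K},\ \frac{\binom{K}{t+1}-\binom{K-\min\{N-1,K\}}{t+1}}{\binom{K}{t}}\right).$$ Then $R_{\mathrm{F}}(M)\le c\cdot R_{\mathrm{F}}^*(M)$, where $c=2$ if $0\le M\le 1$ and $N\ge 2K$; $c=2$ if $0\le M\le \tfrac12$ and $N<2K$; $c=4$ if $\tfrac12\le M\le 1$ and $N<2K$; $c=4$ if $1\le M\le N$ and $N\ge \tfrac{K(K+1)}{2}$; $c=4.0177$ if $1\le M\le N$ and $K<N<\tfrac{K(K+1)}{2}$; $c=5.4606$ if $1\le M\le N$ and $N\le K$.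
   Context: System model. Fix integers $N\ge2$, $K\ge 2$ and a prime power $q$. For a file length $B$, there are $N$ files $W_1,\ldots,W_N$, independent and each uniformly distributed over $\mathbb{F}_q^B$, at a server connected to $K$ users by an error-free shared link. The server generates a random variable $P$ and, for memory size $M\in[0,N]$, fills the cache of user $k$ with $Z_k=\varphi_k(P,W_{[N]})\in\mathbb{F}_q^{\lfloor MB\rfloor}$. Each user $k$ demands one file (demand vector $\mathbf{d}_k\in\{\mathbf{e}_1,\ldots,\mathbf{e}_N\}$, standard unit vectors of $\mathbb{F}_q^N$); demands are independent and independent of $P$ and the files. The server sends $X=\phi(P,\mathbf{d}_{[K]},W_{[N]})\in\mathbb{F}_q^{\lceil RB\rceil}$. Entropies in base $q$. Requirements: correctness $H(W_{\mathbf{d}_k}\mid X,\mathbf{d}_k,Z_k)=0$ for all $k$; privacy $I(\mathbf{d}_{[K]\setminus\mathcal{S}};X,\mathbf{d}_{\mathcal{S}},Z_{\mathcal{S}}\mid W_{[N]})=0$ for every nonempty $\mathcal{S}\subseteq[K]$. $(M,R)$ is achievable if for some $B$ there exist cache and encoding functions satisfying both requirements for all demands; $R_{\mathrm{F}}^*(M)=\liminf_{B\to\infty}\{R:(M,R)\text{ achievable with file length }B\}$ is the optimal load. Binomial convention: $\binom{n}{m}=0$ if $m>n$. *)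

theory Defs
  imports "HOL-Probability.Probability" "HOL-Computational_Algebra.Primes"
begin

text \<open>Information quantities for discrete random variables on a probability space,
  exactly as the abbreviations of HOL-Probability.Information (count spaces on the images).\<close>

definition cond_entropy :: "'w measure \<Rightarrow> real \<Rightarrow> ('w \<Rightarrow> 'a) \<Rightarrow> ('w \<Rightarrow> 'b) \<Rightarrow> real" where
  "cond_entropy \<Omega> b X Y =
     prob_space.conditional_entropy \<Omega> b (count_space (X ` space \<Omega>)) (count_space (Y ` space \<Omega>)) X Y"

definition cond_mutual_info ::
  "'w measure \<Rightarrow> real \<Rightarrow> ('w \<Rightarrow> 'a) \<Rightarrow> ('w \<Rightarrow> 'b) \<Rightarrow> ('w \<Rightarrow> 'c) \<Rightarrow> real" where
  "cond_mutual_info \<Omega> b X Y Z =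
     prob_space.conditional_mutual_information \<Omega> b (count_space (X ` space \<Omega>))
       (count_space (Y ` space \<Omega>)) (count_space (Z ` space \<Omega>)) X Y Z"

text \<open>Files: a list of N files, each a word of length B over the alphabet {0..<q}
  (identified with F_q).  Demands: a list of K file indices in {0..<N}
  (index n stands for the unit vector e_(n+1)).\<close>

definition files_set :: "nat \<Rightarrow> nat \<Rightarrow> nat \<Rightarrow> nat list list set" where
  "files_set N B q = {ws. length ws = N \<and> (\<forall>w\<in>set ws. length w = B \<and> set w \<subseteq> {..<q})}"

definition demand_set :: "nat \<Rightarrow> nat \<Rightarrow> nat list set" where
  "demand_set N K = {ds. length ds = K \<and> set ds \<subseteq> {..<N}}"

definition joint_space :: "nat pmf \<Rightarrow> nat \<Rightarrow> nat \<Rightarrow> nat \<Rightarrow> nat \<Rightarrow> (nat \<times> nat list list \<times> nat list) measure" where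
  "joint_space p N K B q =
     measure_pmf (pair_pmf p (pair_pmf (pmf_of_set (files_set N B q)) (pmf_of_set (demand_set N K))))"

definition achievable :: "nat \<Rightarrow> nat \<Rightarrow> nat \<Rightarrow> real \<Rightarrow> real \<Rightarrow> nat \<Rightarrow> bool" where
  "achievable N K q M R B \<longleftrightarrow>
    (\<exists>(p :: nat pmf) (cache :: nat \<Rightarrow> nat \<Rightarrow> nat list list \<Rightarrow> nat list)
        (enc :: nat \<Rightarrow> nat list \<Rightarrow> nat list list \<Rightarrow> nat list).
      (\<forall>P\<in>set_pmf p. \<forall>ws\<in>files_set N B q. \<forall>k<K.
          length (cache k P ws) = nat \<lfloor>M * real B\<rfloor> \<and> set (cache k P ws) \<subseteq> {..<q}) \<and>
      (\<forall>P\<in>set_pmf p. \<forall>ws\<in>files_set N B q. \<forall>ds\<in>demand_set N K.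
          length (enc P ds ws) = nat \<lceil>R * real B\<rceil> \<and> set (enc P ds ws) \<subseteq> {..<q}) \<and>
      (\<forall>k<K. cond_entropy (joint_space p N K B q) (real q)
          (\<lambda>(P, ws, ds). ws ! (ds ! k))
          (\<lambda>(P, ws, ds). (enc P ds ws, ds ! k, cache k P ws)) = 0) \<and>
      (\<forall>S. S \<noteq> {} \<longrightarrow> S \<subseteq> {..<K} \<longrightarrow>
          cond_mutual_info (joint_space p N K B q) (real q)
            (\<lambda>(P, ws, ds). restrict (\<lambda>k. ds ! k) ({..<K} - S))
            (\<lambda>(P, ws, ds). (enc P ds ws, restrict (\<lambda>k. ds ! k) S, restrict (\<lambda>k. cache k P ws) S))
            (\<lambda>(P, ws, ds). ws) = 0))"

definition R_opt :: "nat \<Rightarrow> nat \<Rightarrow> nat \<Rightarrow> real \<Rightarrow> ereal" where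
  "R_opt N K q M = liminf (\<lambda>B. ereal (Inf {R. 0 \<le> R \<and> achievable N K q M R B}))"

definition Mt :: "nat \<Rightarrow> nat \<Rightarrow> nat \<Rightarrow> real" where
  "Mt N K t = 1 + real t * (real N - 1) / real K"

definition Rt :: "nat \<Rightarrow> nat \<Rightarrow> nat \<Rightarrow> real" where
  "Rt N K t = (real (K choose (t + 1)) - real ((K - min (N - 1) K) choose (t + 1))) / real (K choose t)"

definition lower_convex_envelope :: "(real \<times> real) set \<Rightarrow> real \<Rightarrow> real" where
  "lower_convex_envelope A x = Inf {y. (x, y) \<in> convex hull A}"

definition R_ach :: "nat \<Rightarrow> nat \<Rightarrow> real \<Rightarrow> real" where
  "R_ach N K M = lower_convex_envelope
     (insert (0, real N) ((\<lambda>t. (Mt N K t, Rt N K t)) ` {0..K})) M"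

end

theory Submission
  imports Defs "HOL-Real_Asymp.Real_Asymp"
begin

text \<open>Only lower bounds on the load matter, because \<^const>\<open>R_ach\<close> is the envelope itself. There are two.

  Cut-set bound. Fix the server randomness; then caches and broadcast are functions of the files.
  Choose distinct files \<open>\<pi> 0, \<pi> 1, \<dots>\<close> greedily: given \<open>W\<^bsub>\<pi> 0\<^esub>, \<dots>, W\<^bsub>\<pi> (k - 1)\<^esub>\<close>, the \<open>k + 1\<close>
  caches \<open>Z\<^sub>0, \<dots>, Z\<^sub>k\<close> carry at most \<open>(k + 1) M B\<close> symbols of information about the remaining \<open>N - k\<close> files,
  so some file receives at most the fraction \<open>1 / (N - k)\<close> of it. If user \<open>k\<close> demands file \<open>\<pi> k\<close>, then
  submodularity of entropy yields \<open>R \<ge> s - M (\<Sum>k<s. (k + 1) / (N - k))\<close> for all \<open>s \<le> min N K\<close>.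

  Privacy bound. The joint law of the broadcast \<open>X\<close> and the files does not depend on the demand of user 0.
  Conditioning on each value \<open>n\<close> of that demand shows that \<open>X\<close> determines every single file \<open>W\<^sub>n\<close> up to
  \<open>M B\<close> symbols, whence \<open>R \<ge> N (1 - M)\<close>.

  For \<open>M \<ge> 1\<close> the cut-set bound, interpolated in \<open>s\<close>, is within the factor 4 (respectively 5.4606) of the
  envelope; since the envelope is convex, a bound that is linear in \<open>M\<close> need only be compared with it at the ends
  of an interval.\<close>

text \<open>Correctness survives fixing the server randomness, because a vanishing conditional
  entropy means decodability at every outcome of positive probability. Privacy is a statement about
  the average over that randomness and must be used on the full joint space. The randomness may have
  infinite support, so finiteness is asked of images of the support. At M = 0 the cut-set bound
  gives at most min N K, while the envelope starts at N; for N > K only the privacy bound closes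
  this gap. The comparison involves N, K and M. For M \<ge> 1, K is mostly removed by majorising the
  envelope: K = N - 1 is the worst case if K < N, and the limit of large K is the worst case if N
  \<le> K. The remaining polynomial inequalities are affine in N with nonnegative slope, so the
  smallest admissible N decides. For few files the interpolation loses too much, and explicit
  cut-set bounds with s \<le> 3 take its place.\<close>

section \<open>Entropy of finite-valued functions under a probability mass function\<close>

lemma integrable_pmf_finite_image:
  fixes g :: "'b \<Rightarrow> real"
  assumes "finite (f ` set_pmf J)"
  shows "integrable (measure_pmf J) (\<lambda>x. g (f x))"
proof -
  have "integrable (measure_pmf (map_pmf f J)) g"
    using assms by (intro integrable_measure_pmf_finite) simp
  then show ?thesis by simp
qed

lemma expectation_finite_image:
  fixes g :: "'b \<Rightarrow> real"
  assumes "finite V" "f ` set_pmf J \<subseteq> V"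
  shows "(\<integral>x. g (f x) \<partial>measure_pmf J) = (\<Sum>v\<in>V. g v * pmf (map_pmf f J) v)"
proof -
  have "(\<integral>x. g (f x) \<partial>measure_pmf J) = (\<integral>v. g v \<partial>measure_pmf (map_pmf f J))"
    by simp
  also have "\<dots> = (\<Sum>v\<in>V. g v * pmf (map_pmf f J) v)"
    using assms by (intro integral_measure_pmf_real) auto
  finally show ?thesis .
qed

text \<open>Turns information on which outcomes of the support share a value into an inequality of
  point masses; monotonicity and invariance of entropy follow from it pointwise.\<close>

lemma pmf_map_mono:
  assumes "\<And>y. y \<in> set_pmf J \<Longrightarrow> f y = u \<Longrightarrow> g y = v"
  shows "pmf (map_pmf f J) u \<le> pmf (map_pmf g J) v"
proof -
  have "measure J (f -` {u}) = measure J (f -` {u} \<inter> set_pmf J)"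
    by (simp add: measure_Int_set_pmf)
  also have "\<dots> \<le> measure J (g -` {v})"
    using assms by (intro measure_pmf.finite_measure_mono) auto
  finally show ?thesis by (simp add: pmf_map)
qed

lemma pmf_map_pos: "x \<in> set_pmf J \<Longrightarrow> 0 < pmf (map_pmf f J) (f x)"
  by (simp add: pmf_positive)

lemma sum_pmf_map_pair:
  assumes "finite A" "f ` set_pmf J \<subseteq> A"
  shows "(\<Sum>a\<in>A. pmf (map_pmf (\<lambda>x. (f x, g x)) J) (a, v)) = pmf (map_pmf g J) v"
proof -
  have "(\<Sum>a\<in>A. pmf (map_pmf (\<lambda>x. (f x, g x)) J) (a, v)) =
      (\<Sum>a\<in>A. measure J ((\<lambda>x. (f x, g x)) -` {(a, v)}))"
    by (simp add: pmf_map)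
  also have "\<dots> = measure J (\<Union>a\<in>A. (\<lambda>x. (f x, g x)) -` {(a, v)})"
    using assms by (intro measure_pmf.finite_measure_finite_Union[symmetric])
      (auto simp: disjoint_family_on_def)
  also have "\<dots> = measure J ((\<Union>a\<in>A. (\<lambda>x. (f x, g x)) -` {(a, v)}) \<inter> set_pmf J)"
    by (simp add: measure_Int_set_pmf)
  also have "(\<Union>a\<in>A. (\<lambda>x. (f x, g x)) -` {(a, v)}) \<inter> set_pmf J = g -` {v} \<inter> set_pmf J"
    using assms by auto
  finally show ?thesis by (simp add: pmf_map measure_Int_set_pmf)
qed

text \<open>Expected surprisal instead of a sum over values: entropies of functions with different
  value types can then be compared integrand by integrand on one sample space.\<close>

definition ent :: "real \<Rightarrow> 'w pmf \<Rightarrow> ('w \<Rightarrow> 'a) \<Rightarrow> real" where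
  "ent b J f = - (\<integral>x. log b (pmf (map_pmf f J) (f x)) \<partial>measure_pmf J)"

lemma ent_eq_sum:
  assumes "finite V" "f ` set_pmf J \<subseteq> V"
  shows "ent b J f = - (\<Sum>v\<in>V. pmf (map_pmf f J) v * log b (pmf (map_pmf f J) v))"
  unfolding ent_def expectation_finite_image[OF assms, of "\<lambda>v. log b (pmf (map_pmf f J) v)"]
  by (simp add: mult.commute)

lemma ent_mono:
  assumes b: "1 < b" and fin: "finite (f ` set_pmf J)"
    and det: "\<And>x y. x \<in> set_pmf J \<Longrightarrow> y \<in> set_pmf J \<Longrightarrow> f x = f y \<Longrightarrow> g x = g y"
  shows "ent b J g \<le> ent b J f"
proof -
  define h where "h v = g (SOME y. y \<in> set_pmf J \<and> f y = v)" for v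
  have h: "h (f x) = g x" if "x \<in> set_pmf J" for x
    unfolding h_def
  proof (rule someI2[of _ x])
    show "x \<in> set_pmf J \<and> f x = f x" using that by simp
  qed (use det that in blast)
  then have "g ` set_pmf J = h ` f ` set_pmf J" by force
  then have fin': "finite (g ` set_pmf J)" using fin by simp
  have "(\<integral>x. log b (pmf (map_pmf f J) (f x)) \<partial>measure_pmf J) \<le>
      (\<integral>x. log b (pmf (map_pmf g J) (g x)) \<partial>measure_pmf J)"
  proof (rule integral_mono_AE)
    show "integrable (measure_pmf J) (\<lambda>x. log b (pmf (map_pmf f J) (f x)))"
      by (rule integrable_pmf_finite_image[OF fin])
    show "integrable (measure_pmf J) (\<lambda>x. log b (pmf (map_pmf g J) (g x)))"
      by (rule integrable_pmf_finite_image[OF fin'])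
    show "AE x in measure_pmf J. log b (pmf (map_pmf f J) (f x)) \<le> log b (pmf (map_pmf g J) (g x))"
    proof (rule AE_pmfI)
      fix x assume x: "x \<in> set_pmf J"
      have "pmf (map_pmf f J) (f x) \<le> pmf (map_pmf g J) (g x)"
        by (rule pmf_map_mono) (use det x in blast)
      then show "log b (pmf (map_pmf f J) (f x)) \<le> log b (pmf (map_pmf g J) (g x))"
        using b pmf_map_pos[OF x, of f] by simp
    qed
  qed
  then show ?thesis by (simp add: ent_def)
qed

text \<open>Entropy depends only on the partition induced on the support. This justifies every later
  regrouping of tuples and every insertion of a component that the others determine.\<close>

lemma ent_cong:
  assumes "1 < b" "finite (f ` set_pmf J)"
    and eq: "\<And>x y. x \<in> set_pmf J \<Longrightarrow> y \<in> set_pmf J \<Longrightarrow> f x = f y \<longleftrightarrow> g x = g y"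
  shows "ent b J f = ent b J g"
proof -
  have "pmf (map_pmf f J) (f x) = pmf (map_pmf g J) (g x)" if "x \<in> set_pmf J" for x
    by (intro antisym pmf_map_mono) (use eq that in blast)+
  then have "AE x in measure_pmf J. log b (pmf (map_pmf f J) (f x)) = log b (pmf (map_pmf g J) (g x))"
    by (intro AE_pmfI) simp
  then show ?thesis unfolding ent_def by (simp cong: integral_cong_AE)
qed

lemma ent_map_pmf: "ent b (map_pmf h J) f = ent b J (\<lambda>x. f (h x))"
  unfolding ent_def by (simp add: pmf.map_comp comp_def)

text \<open>Relative entropy is nonnegative; the equality case is what later extracts independence
  from a vanishing mutual information.\<close>

lemma log_sum_gibbs:
  fixes p q :: "'a \<Rightarrow> real"
  assumes b: "1 < b" and V: "finite V"
    and p: "\<And>v. v \<in> V \<Longrightarrow> 0 \<le> p v" and q: "\<And>v. v \<in> V \<Longrightarrow> 0 \<le> q v"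
    and ac: "\<And>v. v \<in> V \<Longrightarrow> 0 < p v \<Longrightarrow> 0 < q v"
    and mass: "sum q V \<le> sum p V"
  shows "0 \<le> (\<Sum>v\<in>V. p v * log b (p v / q v))"
    and "(\<Sum>v\<in>V. p v * log b (p v / q v)) = 0 \<Longrightarrow> v \<in> V \<Longrightarrow> p v = q v"
proof -
  \<comment> \<open>The defect in \<open>ln y \<le> y - 1\<close> at \<open>y = q v / p v\<close>,
    scaled by \<open>p v\<close>; it degenerates to \<open>q v\<close> where \<open>p v = 0\<close>.
    Defects are nonnegative and vanish only if \<open>p v = q v\<close>, so a zero total forces
    equality everywhere.\<close>
  define e where "e v = q v - p v + p v * ln (p v / q v)" for v
  have e: "0 \<le> e v \<and> (e v = 0 \<longrightarrow> p v = q v)" if "v \<in> V" for v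
  proof (cases "p v = 0")
    case True
    then show ?thesis using q[OF that] by (simp add: e_def)
  next
    case False
    then have pos: "0 < p v" "0 < q v" using p[OF that] ac[OF that] by auto
    then have e': "e v = p v * (q v / p v - 1 - ln (q v / p v))"
      by (simp add: e_def field_simps ln_div)
    have "ln (q v / p v) \<le> q v / p v - 1" using pos by (intro ln_le_minus_one) simp
    moreover have "q v / p v = 1" if "ln (q v / p v) = q v / p v - 1"
      using that pos by (intro ln_eq_minus_one) auto
    ultimately show ?thesis using pos by (auto simp: e')
  qed
  have sum_e: "sum e V = sum q V - sum p V + (\<Sum>v\<in>V. p v * ln (p v / q v))"
    by (simp add: e_def sum.distrib sum_subtractf)
  have ln_log: "(\<Sum>v\<in>V. p v * ln (p v / q v)) = ln b * (\<Sum>v\<in>V. p v * log b (p v / q v))"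
    using b by (simp add: sum_distrib_left log_def field_simps)
  have nonneg: "0 \<le> sum e V" using e by (intro sum_nonneg) auto
  with sum_e mass ln_log have "0 \<le> ln b * (\<Sum>v\<in>V. p v * log b (p v / q v))" by linarith
  then show "0 \<le> (\<Sum>v\<in>V. p v * log b (p v / q v))"
    using b by (simp add: zero_le_mult_iff)
  assume "(\<Sum>v\<in>V. p v * log b (p v / q v)) = 0" and v: "v \<in> V"
  with sum_e mass ln_log nonneg have "sum e V = 0" by simp
  then have "e v = 0" using e v V by (subst (asm) sum_nonneg_eq_0_iff) auto
  then show "p v = q v" using e[OF v] by blast
qed

text \<open>Nonnegativity of the relative entropy with respect to the uniform distribution on
  \<open>V\<close>.\<close>

lemma ent_le_log_card:
  assumes b: "1 < b" and V: "finite V" "f ` set_pmf J \<subseteq> V"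
  shows "ent b J f \<le> log b (card V)"
proof -
  let ?p = "pmf (map_pmf f J)"
  have ne: "V \<noteq> {}" using V(2) set_pmf_not_empty[of J] by auto
  then have c: "0 < real (card V)" using V by (simp add: card_gt_0_iff)
  have sump: "sum ?p V = 1" using V by (intro sum_pmf_eq_1) auto
  have "0 \<le> (\<Sum>v\<in>V. ?p v * log b (?p v / (1 / card V)))"
    by (rule log_sum_gibbs(1)[OF b V(1)]) (use c sump in auto)
  also have "\<dots> = (\<Sum>v\<in>V. ?p v * log b (?p v) + ?p v * log b (card V))"
  proof (rule sum.cong[OF refl])
    fix v
    show "?p v * log b (?p v / (1 / card V)) = ?p v * log b (?p v) + ?p v * log b (card V)"
      using c by (cases "?p v = 0") (simp_all add: log_mult distrib_left)
  qed
  also have "\<dots> = - ent b J f + log b (card V)"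
    by (simp add: ent_eq_sum[OF V] sum.distrib sum_distrib_right[symmetric] sump)
  finally show ?thesis by simp
qed

lemma ent_uniform:
  assumes S: "finite S" "S \<noteq> {}" and inj: "inj_on f S"
  shows "ent b (pmf_of_set S) f = log b (card S)"
proof -
  have "pmf (map_pmf f (pmf_of_set S)) (f x) = 1 / card S" if "x \<in> S" for x
    using that S inj by (subst pmf_map_inj) (auto simp: indicator_def)
  then have "ent b (pmf_of_set S) f = - (\<integral>x. log b (1 / real (card S)) \<partial>measure_pmf (pmf_of_set S))"
    unfolding ent_def neg_equal_iff_equal using S by (intro integral_cong_AE AE_pmfI) simp_all
  also have "\<dots> = log b (card S)"
    by (simp add: log_divide log_def ln_div S)
  finally show ?thesis .
qed

context
  fixes b :: real and J :: "'w pmf" and X :: "'w \<Rightarrow> 'a" and Y :: "'w \<Rightarrow> 'b" and Z :: "'w \<Rightarrow> 'c"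
  assumes b: "1 < b"
    and X: "finite (X ` set_pmf J)" and Y: "finite (Y ` set_pmf J)" and Z: "finite (Z ` set_pmf J)"
begin

abbreviation (input) "pz \<equiv> pmf (map_pmf Z J)"
abbreviation (input) "pxz \<equiv> pmf (map_pmf (\<lambda>w. (X w, Z w)) J)"
abbreviation (input) "pyz \<equiv> pmf (map_pmf (\<lambda>w. (Y w, Z w)) J)"
abbreviation (input) "pxyz \<equiv> pmf (map_pmf (\<lambda>w. (X w, Y w, Z w)) J)"

text \<open>All three facts concern the relative entropy of the joint law with respect to the law
  that makes \<open>X\<close> and \<open>Y\<close> conditionally independent given \<open>Z\<close>.
  It is the conditional mutual information, is nonnegative, and vanishes only under conditional
  independence.\<close>

lemma ent_submodular:
    "ent b J (\<lambda>w. (X w, Y w, Z w)) + ent b J Z \<le> ent b J (\<lambda>w. (X w, Z w)) + ent b J (\<lambda>w. (Y w, Z w))"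
    (is ?le)
  and ent_modular_imp_cond_indep:
    "ent b J (\<lambda>w. (X w, Y w, Z w)) + ent b J Z = ent b J (\<lambda>w. (X w, Z w)) + ent b J (\<lambda>w. (Y w, Z w))
      \<Longrightarrow> pxyz (x, y, z) * pz z = pxz (x, z) * pyz (y, z)" (is "?eq \<Longrightarrow> ?indep")
  and ent_modular_expectation:
    "ent b J (\<lambda>w. (X w, Z w)) + ent b J (\<lambda>w. (Y w, Z w)) - ent b J (\<lambda>w. (X w, Y w, Z w)) - ent b J Z =
      (\<integral>w. log b (pxyz (X w, Y w, Z w) / (pxz (X w, Z w) * (pyz (Y w, Z w) / pz (Z w)))) \<partial>measure_pmf J)"
proof -
  let ?A = "X ` set_pmf J" and ?B = "Y ` set_pmf J" and ?C = "Z ` set_pmf J"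
  let ?V = "?A \<times> ?B \<times> ?C"
  define q where "q = (\<lambda>(x, y, z). pxz (x, z) * (pyz (y, z) / pz z))"
  have finV: "finite ?V" using X Y Z by simp
  have sub: "(\<lambda>w. (X w, Y w, Z w)) ` set_pmf J \<subseteq> ?V" by auto
  have zpos: "0 < pz z" if "z \<in> ?C" for z
    using that by (auto simp: pmf_positive)
  have "sum q ?V = (\<Sum>x\<in>?A. \<Sum>y\<in>?B. \<Sum>z\<in>?C. pxz (x, z) * (pyz (y, z) / pz z))"
    by (simp add: q_def sum.cartesian_product)
  also have "\<dots> = (\<Sum>x\<in>?A. \<Sum>z\<in>?C. \<Sum>y\<in>?B. pxz (x, z) * (pyz (y, z) / pz z))"
    by (intro sum.cong refl sum.swap)
  also have "\<dots> = (\<Sum>x\<in>?A. \<Sum>z\<in>?C. pxz (x, z))"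
  proof (intro sum.cong refl)
    fix x z assume "z \<in> ?C"
    then show "(\<Sum>y\<in>?B. pxz (x, z) * (pyz (y, z) / pz z)) = pxz (x, z)"
      using zpos[of z] Y
      by (simp add: sum_distrib_left[symmetric] sum_divide_distrib[symmetric] sum_pmf_map_pair)
  qed
  also have "\<dots> = (\<Sum>z\<in>?C. \<Sum>x\<in>?A. pxz (x, z))" by (rule sum.swap)
  also have "\<dots> = (\<Sum>z\<in>?C. pz z)"
    using X by (simp add: sum_pmf_map_pair)
  also have "\<dots> = 1" using Z by (intro sum_pmf_eq_1) auto
  finally have sumq: "sum q ?V = 1" .
  have sump: "sum pxyz ?V = 1" using finV sub by (intro sum_pmf_eq_1) auto
  have int: "integrable (measure_pmf J) (\<lambda>w. log b (pxyz (X w, Y w, Z w)))"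
      "integrable (measure_pmf J) (\<lambda>w. log b (pxz (X w, Z w)))"
      "integrable (measure_pmf J) (\<lambda>w. log b (pyz (Y w, Z w)))"
      "integrable (measure_pmf J) (\<lambda>w. log b (pz (Z w)))"
  proof -
    have fin: "finite ((\<lambda>w. (X w, Y w, Z w)) ` set_pmf J)" "finite ((\<lambda>w. (X w, Z w)) ` set_pmf J)"
        "finite ((\<lambda>w. (Y w, Z w)) ` set_pmf J)"
      using finV X Y Z
      by (auto intro: finite_subset[OF sub] finite_subset[of _ "?A \<times> ?C"] finite_subset[of _ "?B \<times> ?C"])
    show "integrable (measure_pmf J) (\<lambda>w. log b (pxyz (X w, Y w, Z w)))"
      using integrable_pmf_finite_image[OF fin(1), of "\<lambda>v. log b (pxyz v)"] .
    show "integrable (measure_pmf J) (\<lambda>w. log b (pxz (X w, Z w)))"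
      using integrable_pmf_finite_image[OF fin(2), of "\<lambda>v. log b (pxz v)"] .
    show "integrable (measure_pmf J) (\<lambda>w. log b (pyz (Y w, Z w)))"
      using integrable_pmf_finite_image[OF fin(3), of "\<lambda>v. log b (pyz v)"] .
    show "integrable (measure_pmf J) (\<lambda>w. log b (pz (Z w)))"
      using integrable_pmf_finite_image[OF Z, of "\<lambda>v. log b (pz v)"] .
  qed
  show ex: "ent b J (\<lambda>w. (X w, Z w)) + ent b J (\<lambda>w. (Y w, Z w)) - ent b J (\<lambda>w. (X w, Y w, Z w)) - ent b J Z =
      (\<integral>w. log b (pxyz (X w, Y w, Z w) / (pxz (X w, Z w) * (pyz (Y w, Z w) / pz (Z w)))) \<partial>measure_pmf J)"
  proof -
    have "(\<integral>w. log b (pxyz (X w, Y w, Z w) / (pxz (X w, Z w) * (pyz (Y w, Z w) / pz (Z w)))) \<partial>measure_pmf J) =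
       (\<integral>w. log b (pxyz (X w, Y w, Z w)) - log b (pxz (X w, Z w)) - log b (pyz (Y w, Z w))
          + log b (pz (Z w)) \<partial>measure_pmf J)"
    proof (intro integral_cong_AE AE_pmfI)
      fix w assume w: "w \<in> set_pmf J"
      show "log b (pxyz (X w, Y w, Z w) / (pxz (X w, Z w) * (pyz (Y w, Z w) / pz (Z w)))) =
        log b (pxyz (X w, Y w, Z w)) - log b (pxz (X w, Z w)) - log b (pyz (Y w, Z w)) + log b (pz (Z w))"
        using pmf_map_pos[OF w, of "\<lambda>w. (X w, Y w, Z w)"] pmf_map_pos[OF w, of "\<lambda>w. (X w, Z w)"]
          pmf_map_pos[OF w, of "\<lambda>w. (Y w, Z w)"] pmf_map_pos[OF w, of Z] b
        by (simp add: log_divide log_mult)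
    qed auto
    also have "\<dots> = ent b J (\<lambda>w. (X w, Z w)) + ent b J (\<lambda>w. (Y w, Z w)) - ent b J (\<lambda>w. (X w, Y w, Z w)) - ent b J Z"
      using int by (simp add: ent_def)
    finally show ?thesis by simp
  qed
  have kl: "(\<integral>w. log b (pxyz (X w, Y w, Z w) / (pxz (X w, Z w) * (pyz (Y w, Z w) / pz (Z w)))) \<partial>measure_pmf J)
      = (\<Sum>v\<in>?V. pxyz v * log b (pxyz v / q v))"
    using expectation_finite_image[OF finV sub, of "\<lambda>v. log b (pxyz v / q v)"]
    by (simp add: q_def mult.commute)
  have ac: "0 < q v" if v: "0 < pxyz v" for v
  proof -
    from v have "v \<in> set_pmf (map_pmf (\<lambda>w. (X w, Y w, Z w)) J)"
      by (metis pmf_eq_0_set_pmf less_irrefl)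
    then obtain w where w: "w \<in> set_pmf J" "v = (X w, Y w, Z w)" by auto
    then show ?thesis
      using pmf_map_pos[OF w(1), of "\<lambda>w. (X w, Z w)"]
          pmf_map_pos[OF w(1), of "\<lambda>w. (Y w, Z w)"] pmf_map_pos[OF w(1), of Z]
      by (simp add: q_def)
  qed
  have qnn: "0 \<le> q v" for v by (simp add: q_def split: prod.split)
  have mass: "sum q ?V \<le> sum pxyz ?V" using sump sumq by simp
  have gibbs: "0 \<le> (\<Sum>v\<in>?V. pxyz v * log b (pxyz v / q v))"
    by (rule log_sum_gibbs(1)[OF b finV]) (use ac qnn mass in auto)
  show ?le using gibbs kl ex by linarith
  assume ?eq
  then have z0: "(\<Sum>v\<in>?V. pxyz v * log b (pxyz v / q v)) = 0" using kl ex by linarith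
  show ?indep
  proof (cases "(x, y, z) \<in> ?V")
    case True
    have "pxyz (x, y, z) = q (x, y, z)"
      by (rule log_sum_gibbs(2)[OF b finV _ _ _ mass z0 True]) (use ac qnn in auto)
    then show ?thesis using zpos[of z] True by (simp add: q_def field_simps)
  next
    case False
    then have "pxyz (x, y, z) = 0" "pxz (x, z) = 0 \<or> pyz (y, z) = 0"
      by (auto simp: pmf_eq_0_set_pmf image_iff)
    then show ?thesis by auto
  qed
qed

end

section \<open>Conditional entropy and conditional mutual information as entropies\<close>

text \<open>\<open>cond_entropy\<close> and \<open>cond_mutual_info\<close> use count spaces over
  the image of the whole sample space, hence over \<open>range f\<close>, although the mass sits on
  the image of the support. The set \<open>A\<close> covers this larger range.\<close>

lemma distributed_pmf:
  assumes "range f \<subseteq> A"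
  shows "distributed (measure_pmf J) (count_space A) f (\<lambda>v. ennreal (pmf (map_pmf f J) v))"
  unfolding distributed_def
proof (intro conjI)
  show f: "f \<in> measurable (measure_pmf J) (count_space A)"
    using assms by (auto simp: measurable_def)
  show "distr (measure_pmf J) (count_space A) f =
      density (count_space A) (\<lambda>v. ennreal (pmf (map_pmf f J) v))"
  proof (rule measure_eqI)
    fix B assume "B \<in> sets (distr (measure_pmf J) (count_space A) f)"
    then have B: "B \<subseteq> A" by simp
    have "emeasure (distr (measure_pmf J) (count_space A) f) B = emeasure (map_pmf f J) B"
      using B f by (simp add: emeasure_distr)
    also have "\<dots> = (\<integral>\<^sup>+v. indicator B v \<partial>measure_pmf (map_pmf f J))"
      by (subst nn_integral_indicator) auto
    also have "\<dots> = (\<integral>\<^sup>+v. ennreal (pmf (map_pmf f J) v) * indicator B v \<partial>count_space UNIV)"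
      by (rule nn_integral_measure_pmf)
    also have "\<dots> = (\<integral>\<^sup>+v. ennreal (pmf (map_pmf f J) v) * indicator B v \<partial>count_space A)"
      by (rule nn_integral_count_space_eq) (use B in \<open>auto simp: indicator_def\<close>)
    also have "\<dots> = emeasure (density (count_space A) (\<lambda>v. ennreal (pmf (map_pmf f J) v))) B"
      using B by (simp add: emeasure_density)
    finally show "emeasure (distr (measure_pmf J) (count_space A) f) B =
      emeasure (density (count_space A) (\<lambda>v. ennreal (pmf (map_pmf f J) v))) B" .
  qed simp
qed simp

lemma integrable_count_space_finite_support:
  fixes g :: "'a \<Rightarrow> real"
  assumes fin: "finite {v \<in> A. g v \<noteq> 0}"
  shows "integrable (count_space A) g"
proof -
  let ?B = "{v \<in> A. g v \<noteq> 0}"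
  have "integrable (count_space A) (\<lambda>x. \<Sum>v\<in>?B. indicator {v} x *\<^sub>R g v)"
  proof (intro Bochner_Integration.integrable_sum integrable_scaleR_left integrable_real_indicator)
    fix v assume "v \<in> ?B"
    then show "{v} \<in> sets (count_space A)" "emeasure (count_space A) {v} < \<infinity>" by simp_all
  qed
  moreover have "g x = (\<Sum>v\<in>?B. indicator {v} x *\<^sub>R g v)" if "x \<in> A" for x
  proof -
    have "(\<Sum>v\<in>?B. indicator {v} x *\<^sub>R g v) = (\<Sum>v\<in>?B. if x = v then g v else 0)"
      by (intro sum.cong) (auto simp: indicator_def)
    also have "\<dots> = g x" using fin that by (subst sum.delta') auto
    finally show ?thesis by simp
  qed
  ultimately show ?thesis
    by (subst Bochner_Integration.integrable_cong[OF refl]) auto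
qed

lemma integral_count_space_pmf:
  fixes g :: "'b \<Rightarrow> real"
  assumes "finite (f ` set_pmf J)" "range f \<subseteq> A"
  shows "(\<integral>v. pmf (map_pmf f J) v * g v \<partial>count_space A) = (\<integral>x. g (f x) \<partial>measure_pmf J)"
    and "integrable (count_space A) (\<lambda>v. pmf (map_pmf f J) v * g v)"
proof -
  have nz: "{v \<in> A. pmf (map_pmf f J) v * g v \<noteq> 0} \<subseteq> f ` set_pmf J"
    by (auto simp: pmf_eq_0_set_pmf)
  then have fin: "finite {v \<in> A. pmf (map_pmf f J) v * g v \<noteq> 0}"
    using assms(1) finite_subset by blast
  show "integrable (count_space A) (\<lambda>v. pmf (map_pmf f J) v * g v)"
    using fin by (rule integrable_count_space_finite_support)
  have "(\<integral>v. pmf (map_pmf f J) v * g v \<partial>count_space A) =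
      (\<Sum>v | v \<in> A \<and> pmf (map_pmf f J) v * g v \<noteq> 0. pmf (map_pmf f J) v * g v)"
    by (rule lebesgue_integral_count_space_finite_support[OF fin])
  also have "\<dots> = (\<Sum>v\<in>f ` set_pmf J. pmf (map_pmf f J) v * g v)"
    by (rule sum.mono_neutral_left) (use assms nz in auto)
  also have "\<dots> = (\<integral>x. g (f x) \<partial>measure_pmf J)"
    using expectation_finite_image[OF assms(1) order_refl, of g] by (simp add: mult.commute)
  finally show "(\<integral>v. pmf (map_pmf f J) v * g v \<partial>count_space A) = (\<integral>x. g (f x) \<partial>measure_pmf J)" .
qed

text \<open>Countability turns the product of the two count spaces into the count space on
  pairs.\<close>

lemma distributed_pmf_pair:
  fixes X :: "'w::countable \<Rightarrow> 'a" and Y :: "'w \<Rightarrow> 'b"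
  assumes "range X \<subseteq> A" "range Y \<subseteq> B" "countable A" "countable B"
  shows "distributed (measure_pmf J) (count_space A \<Otimes>\<^sub>M count_space B) (\<lambda>w. (X w, Y w))
    (\<lambda>v. ennreal (pmf (map_pmf (\<lambda>w. (X w, Y w)) J) v))"
  unfolding pair_measure_countable[OF assms(3,4)]
  by (rule distributed_pmf) (use assms in auto)

lemma sigma_finite_count_space_range:
  "sigma_finite_measure (count_space (range (f :: 'w::countable \<Rightarrow> 'a)))"
  by (rule sigma_finite_measure_count_space_countable) simp

lemma cond_entropy_eq_ent:
  fixes X :: "'w::countable \<Rightarrow> 'a" and Y :: "'w \<Rightarrow> 'b"
  assumes b: "1 < b" and X: "finite (X ` set_pmf J)" and Y: "finite (Y ` set_pmf J)"
  shows "cond_entropy (measure_pmf J) b X Y = ent b J (\<lambda>w. (X w, Y w)) - ent b J Y"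
proof -
  interpret information_space "measure_pmf J" b by unfold_locales (rule b)
  let ?pxy = "pmf (map_pmf (\<lambda>w. (X w, Y w)) J)" and ?py = "pmf (map_pmf Y J)"
  let ?S = "count_space (range X)" and ?T = "count_space (range Y)"
  have fin: "finite ((\<lambda>w. (X w, Y w)) ` set_pmf J)"
    by (rule finite_subset[of _ "X ` set_pmf J \<times> Y ` set_pmf J"]) (use X Y in auto)
  have ST: "?S \<Otimes>\<^sub>M ?T = count_space (range X \<times> range Y)"
    by (rule pair_measure_countable) auto
  have "cond_entropy (measure_pmf J) b X Y = prob_space.conditional_entropy (measure_pmf J) b ?S ?T X Y"
    by (simp add: cond_entropy_def)
  also have "\<dots> = - (\<integral>(x, y). ?pxy (x, y) * log b (?pxy (x, y) / ?py y) \<partial>(?S \<Otimes>\<^sub>M ?T))"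
    by (rule conditional_entropy_generic_eq[OF sigma_finite_count_space_range sigma_finite_count_space_range])
      (auto intro: distributed_pmf distributed_pmf_pair)
  also have "\<dots> = - (\<integral>v. ?pxy v * log b (?pxy v / ?py (snd v)) \<partial>count_space (range X \<times> range Y))"
    by (simp add: ST case_prod_unfold)
  also have "\<dots> = - (\<integral>w. log b (?pxy (X w, Y w) / ?py (Y w)) \<partial>measure_pmf J)"
    by (subst integral_count_space_pmf(1)[OF fin]) auto
  also have "(\<integral>w. log b (?pxy (X w, Y w) / ?py (Y w)) \<partial>measure_pmf J) =
      (\<integral>w. log b (?pxy (X w, Y w)) - log b (?py (Y w)) \<partial>measure_pmf J)"
  proof (intro integral_cong_AE AE_pmfI)
    fix w assume w: "w \<in> set_pmf J"
    show "log b (?pxy (X w, Y w) / ?py (Y w)) = log b (?pxy (X w, Y w)) - log b (?py (Y w))"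
      using pmf_map_pos[OF w, of "\<lambda>w. (X w, Y w)"] pmf_map_pos[OF w, of Y]
      by (simp add: log_divide)
  qed auto
  also have "\<dots> = - ent b J (\<lambda>w. (X w, Y w)) + ent b J Y"
    using integrable_pmf_finite_image[OF fin, of "\<lambda>v. log b (?pxy v)"]
      integrable_pmf_finite_image[OF Y, of "\<lambda>v. log b (?py v)"] by (simp add: ent_def)
  finally show ?thesis by simp
qed

lemma cond_mutual_info_eq_ent:
  fixes X :: "'w::countable \<Rightarrow> 'a" and Y :: "'w \<Rightarrow> 'b" and Z :: "'w \<Rightarrow> 'c"
  assumes b: "1 < b" and X: "finite (X ` set_pmf J)" and Y: "finite (Y ` set_pmf J)"
    and Z: "finite (Z ` set_pmf J)"
  shows "cond_mutual_info (measure_pmf J) b X Y Z =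
    ent b J (\<lambda>w. (X w, Z w)) + ent b J (\<lambda>w. (Y w, Z w)) - ent b J (\<lambda>w. (X w, Y w, Z w)) - ent b J Z"
proof -
  interpret information_space "measure_pmf J" b by unfold_locales (rule b)
  let ?px = "pmf (map_pmf X J)" and ?pz = "pmf (map_pmf Z J)"
    and ?pxz = "pmf (map_pmf (\<lambda>w. (X w, Z w)) J)" and ?pyz = "pmf (map_pmf (\<lambda>w. (Y w, Z w)) J)"
    and ?pxyz = "pmf (map_pmf (\<lambda>w. (X w, Y w, Z w)) J)"
  let ?S = "count_space (range X)" and ?T = "count_space (range Y)" and ?P = "count_space (range Z)"
  have fin: "finite ((\<lambda>w. (X w, Y w, Z w)) ` set_pmf J)"
    by (rule finite_subset[of _ "X ` set_pmf J \<times> Y ` set_pmf J \<times> Z ` set_pmf J"]) (use X Y Z in auto)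
  have TP: "?T \<Otimes>\<^sub>M ?P = count_space (range Y \<times> range Z)"
    by (rule pair_measure_countable) auto
  have STP: "?S \<Otimes>\<^sub>M ?T \<Otimes>\<^sub>M ?P = count_space (range X \<times> range Y \<times> range Z)"
    unfolding TP by (rule pair_measure_countable) auto
  have sub: "range (\<lambda>w. (X w, Y w, Z w)) \<subseteq> range X \<times> range Y \<times> range Z" by auto
  note eq = integral_count_space_pmf[OF fin sub]
  have "cond_mutual_info (measure_pmf J) b X Y Z = prob_space.conditional_mutual_information (measure_pmf J) b ?S ?T ?P X Y Z"
    by (simp add: cond_mutual_info_def)
  also have "\<dots> = (\<integral>(x, y, z). ?pxyz (x, y, z) *
      log b (?pxyz (x, y, z) / (?pxz (x, z) * (?pyz (y, z) / ?pz z))) \<partial>(?S \<Otimes>\<^sub>M ?T \<Otimes>\<^sub>M ?P))"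
  proof (rule conditional_mutual_information_generic_eq[OF sigma_finite_count_space_range
        sigma_finite_count_space_range sigma_finite_count_space_range, where Px = ?px])
    show "distributed (measure_pmf J) (?S \<Otimes>\<^sub>M ?T \<Otimes>\<^sub>M ?P) (\<lambda>w. (X w, Y w, Z w)) (\<lambda>v. ennreal (?pxyz v))"
      unfolding STP by (rule distributed_pmf[OF sub])
    show "integrable (?S \<Otimes>\<^sub>M ?T \<Otimes>\<^sub>M ?P)
       (\<lambda>(x, y, z). ?pxyz (x, y, z) * log b (?pxyz (x, y, z) / (?px x * ?pyz (y, z))))"
      using eq(2)[of "\<lambda>v. log b (?pxyz v / (?px (fst v) * ?pyz (snd v)))"]
      by (simp add: STP case_prod_unfold)
    show "integrable (?S \<Otimes>\<^sub>M ?T \<Otimes>\<^sub>M ?P)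
       (\<lambda>(x, y, z). ?pxyz (x, y, z) * log b (?pxz (x, z) / (?px x * ?pz z)))"
      using eq(2)[of "\<lambda>v. log b (?pxz (fst v, snd (snd v)) / (?px (fst v) * ?pz (snd (snd v))))"]
      by (simp add: STP case_prod_unfold)
  qed (auto intro: distributed_pmf distributed_pmf_pair)
  also have "\<dots> = (\<integral>w. log b (?pxyz (X w, Y w, Z w) / (?pxz (X w, Z w) * (?pyz (Y w, Z w) / ?pz (Z w)))) \<partial>measure_pmf J)"
    using eq(1)[of "\<lambda>v. log b (?pxyz v / (?pxz (fst v, snd (snd v)) * (?pyz (snd v) / ?pz (snd (snd v)))))"]
    by (simp add: STP case_prod_unfold)
  also have "\<dots> = ent b J (\<lambda>w. (X w, Z w)) + ent b J (\<lambda>w. (Y w, Z w)) - ent b J (\<lambda>w. (X w, Y w, Z w)) - ent b J Z"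
    by (rule ent_modular_expectation[OF b X Y Z, symmetric])
  finally show ?thesis .
qed

text \<open>The surprisal of the pair exceeds that of \<open>Y\<close> pointwise, so a zero mean
  difference makes the point masses agree on the support. Two outcomes with equal \<open>Y\<close>
  but different \<open>X\<close> would have to share the mass of one value of \<open>Y\<close>, a
  contradiction.\<close>

lemma cond_entropy_zero_imp_determined:
  fixes X :: "'w::countable \<Rightarrow> 'a" and Y :: "'w \<Rightarrow> 'b"
  assumes b: "1 < b" and X: "finite (X ` set_pmf J)" and Y: "finite (Y ` set_pmf J)"
    and zero: "cond_entropy (measure_pmf J) b X Y = 0"
    and xy: "x \<in> set_pmf J" "y \<in> set_pmf J" "Y x = Y y"
  shows "X x = X y"
proof (rule ccontr)
  assume neq: "X x \<noteq> X y"
  let ?pxy = "\<lambda>w. pmf (map_pmf (\<lambda>w. (X w, Y w)) J) (X w, Y w)" and ?py = "\<lambda>w. pmf (map_pmf Y J) (Y w)"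
  have fin: "finite ((\<lambda>w. (X w, Y w)) ` set_pmf J)"
    by (rule finite_subset[of _ "X ` set_pmf J \<times> Y ` set_pmf J"]) (use X Y in auto)
  have int: "integrable (measure_pmf J) (\<lambda>w. log b (?pxy w))" "integrable (measure_pmf J) (\<lambda>w. log b (?py w))"
    using integrable_pmf_finite_image[OF fin, of "\<lambda>v. log b (pmf (map_pmf (\<lambda>w. (X w, Y w)) J) v)"]
      integrable_pmf_finite_image[OF Y, of "\<lambda>v. log b (pmf (map_pmf Y J) v)"] by auto
  have le: "?pxy w \<le> ?py w" for w by (rule pmf_map_mono) auto
  have "(\<integral>w. log b (?py w) - log b (?pxy w) \<partial>measure_pmf J) = 0"
    using int zero cond_entropy_eq_ent[OF b X Y] by (simp add: ent_def)
  moreover have "AE w in measure_pmf J. 0 \<le> log b (?py w) - log b (?pxy w)"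
  proof (rule AE_pmfI)
    fix w assume "w \<in> set_pmf J"
    then show "0 \<le> log b (?py w) - log b (?pxy w)"
      using le[of w] b pmf_map_pos[of w J "\<lambda>w. (X w, Y w)"] by simp
  qed
  ultimately have "AE w in measure_pmf J. log b (?py w) - log b (?pxy w) = 0"
    using int by (subst (asm) integral_nonneg_eq_0_iff_AE) auto
  then have "log b (?py x) = log b (?pxy x)" using xy(1) by (auto simp: AE_measure_pmf_iff)
  then have "?py x = ?pxy x"
    using b pmf_map_pos[OF xy(1), of Y] pmf_map_pos[OF xy(1), of "\<lambda>w. (X w, Y w)"] by (simp add: log_def)
  moreover have "?pxy x + ?pxy y \<le> ?py x"
  proof -
    have "?pxy x + ?pxy y = measure J ((\<lambda>w. (X w, Y w)) -` {(X x, Y x)} \<union> (\<lambda>w. (X w, Y w)) -` {(X y, Y y)})"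
      unfolding pmf_map using neq by (subst measure_pmf.finite_measure_Union) auto
    also have "\<dots> \<le> measure J (Y -` {Y x})"
      using xy(3) by (intro measure_pmf.finite_measure_mono) auto
    finally show ?thesis by (simp add: pmf_map)
  qed
  ultimately show False using pmf_map_pos[OF xy(2), of "\<lambda>w. (X w, Y w)"] by simp
qed

section \<open>Entropy converse bounds\<close>

text \<open>A family of random variables packed into one. Outside \<open>A\<close> the value is
  \<open>undefined\<close>, so two blocks agree exactly when all components in \<open>A\<close>
  agree.\<close>

abbreviation (input) block :: "(nat \<Rightarrow> 'w \<Rightarrow> 'a) \<Rightarrow> nat set \<Rightarrow> 'w \<Rightarrow> nat \<Rightarrow> 'a" where
  "block f A \<equiv> \<lambda>w. restrict (\<lambda>i. f i w) A"

lemma restrict_eq_iff: "restrict f A = restrict g A \<longleftrightarrow> (\<forall>i\<in>A. f i = g i)"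
  by (auto simp: restrict_def fun_eq_iff)

lemma block_image_subset:
  assumes "\<And>i w. i \<in> A \<Longrightarrow> w \<in> set_pmf J \<Longrightarrow> f i w \<in> V"
  shows "block f A ` set_pmf J \<subseteq> A \<rightarrow>\<^sub>E V"
  using assms by auto

lemma finite_block_image:
  assumes "finite A" "finite V" "\<And>i w. i \<in> A \<Longrightarrow> w \<in> set_pmf J \<Longrightarrow> f i w \<in> V"
  shows "finite (block f A ` set_pmf J)"
  using finite_subset[OF block_image_subset[of A J f V]] assms by (simp add: finite_PiE)

lemma finite_pair_image:
  assumes "finite (f ` S)" "finite (g ` S)"
  shows "finite ((\<lambda>w. (f w, g w)) ` S)"
  by (rule finite_subset[of _ "f ` S \<times> g ` S"]) (use assms in auto)

lemma ent_const: "ent b J (\<lambda>_. c) = 0"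
  by (simp add: ent_def)

lemma ent_pair_le:
  assumes b: "1 < b" and f: "finite (f ` set_pmf J)" and g: "finite (g ` set_pmf J)"
  shows "ent b J (\<lambda>w. (f w, g w)) \<le> ent b J f + ent b J g"
proof -
  have "ent b J (\<lambda>w. (f w, g w, ())) + ent b J (\<lambda>_. ()) \<le> ent b J (\<lambda>w. (f w, ())) + ent b J (\<lambda>w. (g w, ()))"
    by (rule ent_submodular[OF b f g]) simp
  moreover have "ent b J (\<lambda>w. (f w, g w)) = ent b J (\<lambda>w. (f w, g w, ()))"
    by (rule ent_cong[OF b finite_pair_image[OF f g]]) auto
  moreover have "ent b J f = ent b J (\<lambda>w. (f w, ()))" by (rule ent_cong[OF b f]) auto
  moreover have "ent b J g = ent b J (\<lambda>w. (g w, ()))" by (rule ent_cong[OF b g]) auto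
  ultimately show ?thesis by (simp add: ent_const)
qed

lemma ent_block_le:
  assumes b: "1 < b" and A: "finite A" and V: "finite V"
    and f: "\<And>i w. i \<in> A \<Longrightarrow> w \<in> set_pmf J \<Longrightarrow> f i w \<in> V"
  shows "ent b J (block f A) \<le> card A * log b (card V)"
proof -
  have "ent b J (block f A) \<le> log b (card (A \<rightarrow>\<^sub>E V))"
    by (rule ent_le_log_card[OF b]) (use A V f in \<open>auto simp: finite_PiE\<close>)
  then show ?thesis by (simp add: card_PiE A log_nat_power)
qed

text \<open>Each element of \<open>C\<close> is split off by submodularity, conditioning on
  \<open>U\<close> and the block over \<open>A\<close>. The role of \<open>U\<close> is taken by the
  caches in the cut-set bound and by the broadcast in the privacy bound.\<close>

lemma ent_block_increments:
  assumes b: "1 < b" and U: "finite (U ` set_pmf J)" and V: "finite V"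
    and f: "\<And>i w. i \<in> A \<union> C \<Longrightarrow> w \<in> set_pmf J \<Longrightarrow> f i w \<in> V"
    and A: "finite A" and C: "finite C"
  shows "ent b J (\<lambda>w. (U w, block f (A \<union> C) w)) - ent b J (\<lambda>w. (U w, block f A w)) \<le>
    (\<Sum>n\<in>C. ent b J (\<lambda>w. (U w, block f (insert n A) w)) - ent b J (\<lambda>w. (U w, block f A w)))"
  using C f
proof (induction C rule: finite_induct)
  case empty
  then show ?case by simp
next
  case (insert n C)
  have fin: "finite (block f D ` set_pmf J)" if "D \<subseteq> A \<union> insert n C" for D
    by (rule finite_block_image[OF finite_subset[OF that] V]) (use that insert A in auto)
  have fn: "finite (f n ` set_pmf J)"
    by (rule finite_subset[OF _ V]) (use insert in auto)
  have "ent b J (\<lambda>w. (block f C w, f n w, U w, block f A w)) + ent b J (\<lambda>w. (U w, block f A w)) \<le>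
      ent b J (\<lambda>w. (block f C w, U w, block f A w)) + ent b J (\<lambda>w. (f n w, U w, block f A w))"
    by (rule ent_submodular[OF b _ fn finite_pair_image[OF U]]) (auto intro!: fin)
  moreover have "ent b J (\<lambda>w. (U w, block f (A \<union> insert n C) w)) = ent b J (\<lambda>w. (block f C w, f n w, U w, block f A w))"
    by (rule ent_cong[OF b finite_pair_image[OF U fin]]) (auto simp: restrict_eq_iff)
  moreover have "ent b J (\<lambda>w. (U w, block f (A \<union> C) w)) = ent b J (\<lambda>w. (block f C w, U w, block f A w))"
    by (rule ent_cong[OF b finite_pair_image[OF U fin]]) (auto simp: restrict_eq_iff)
  moreover have "ent b J (\<lambda>w. (U w, block f (insert n A) w)) = ent b J (\<lambda>w. (f n w, U w, block f A w))"
    by (rule ent_cong[OF b finite_pair_image[OF U fin]]) (auto simp: restrict_eq_iff)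
  moreover have "ent b J (\<lambda>w. (U w, block f (A \<union> C) w)) - ent b J (\<lambda>w. (U w, block f A w)) \<le>
    (\<Sum>n\<in>C. ent b J (\<lambda>w. (U w, block f (insert n A) w)) - ent b J (\<lambda>w. (U w, block f A w)))"
    by (rule insert.IH) (use insert.prems in auto)
  ultimately show ?case
    unfolding sum.insert[OF insert.hyps(1,2)] by linarith
qed

text \<open>Averaging: the \<open>k\<close> caches and the known files carry at most
  \<open>k * m + card A * B\<close>, so the r = N - card A remaining files together add at least r B
  - k m. Their separate gains sum to at least that, hence one of them reaches the average.\<close>

lemma exists_informative_file:
  fixes B m :: real
  assumes b: "1 < b" and VW: "finite VW" and VZ: "finite VZ"
    and W: "\<And>i w. i < N \<Longrightarrow> w \<in> set_pmf J \<Longrightarrow> W i w \<in> VW"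
    and Z: "\<And>i w. i < k \<Longrightarrow> w \<in> set_pmf J \<Longrightarrow> Z i w \<in> VZ"
    and cW: "log b (card VW) \<le> B" and cZ: "log b (card VZ) \<le> m"
    and full: "real N * B \<le> ent b J (block W {..<N})"
    and A: "A \<subseteq> {..<N}" "card A < N"
  shows "\<exists>n\<in>{..<N} - A. B - real k * m / (real N - real (card A)) \<le>
    ent b J (\<lambda>w. (block Z {..<k} w, block W (insert n A) w)) - ent b J (\<lambda>w. (block Z {..<k} w, block W A w))"
proof (rule ccontr)
  let ?h = "\<lambda>A. ent b J (\<lambda>w. (block Z {..<k} w, block W A w))"
  let ?C = "{..<N} - A"
  define r where "r = real N - real (card A)"
  assume "\<not> ?thesis"
  then have less: "?h (insert n A) - ?h A < B - real k * m / r" if "n \<in> ?C" for n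
    using that by (auto simp: not_le r_def)
  have finA: "finite A" using A finite_subset by blast
  have r: "0 < r" "real (card ?C) = r"
    using A finA by (simp_all add: card_Diff_subset r_def)
  have ne: "?C \<noteq> {}" using r by (metis card.empty less_irrefl of_nat_0)
  have finZ: "finite (block Z {..<k} ` set_pmf J)"
    by (rule finite_block_image[OF _ VZ]) (use Z in auto)
  have finW: "finite (block W D ` set_pmf J)" if "D \<subseteq> {..<N}" for D
    by (rule finite_block_image[OF finite_subset[OF that] VW]) (use that W in auto)
  have un: "A \<union> ?C = {..<N}" using A by auto
  have "?h {..<N} - ?h A \<le> (\<Sum>n\<in>?C. ?h (insert n A) - ?h A)"
    using ent_block_increments[OF b finZ VW _ finA, of ?C W] W unfolding un by blast
  also have "\<dots> < (\<Sum>n\<in>?C. B - real k * m / r)"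
    by (rule sum_strict_mono) (use ne less in auto)
  also have "\<dots> = r * B - real k * m" using r by (simp add: algebra_simps)
  finally have 1: "?h {..<N} - ?h A < r * B - real k * m" .
  have "real N * B \<le> ?h {..<N}"
    by (rule order_trans[OF full ent_mono[OF b finite_pair_image[OF finZ finW]]]) auto
  moreover have "?h A \<le> ent b J (block Z {..<k}) + ent b J (block W A)"
    by (rule ent_pair_le[OF b finZ finW[OF A(1)]])
  moreover have "ent b J (block Z {..<k}) \<le> real (card {..<k}) * log b (card VZ)"
    by (rule ent_block_le[OF b _ VZ]) (use Z in auto)
  moreover have "real (card {..<k}) * log b (card VZ) \<le> real k * m"
    using cZ by (auto intro: mult_left_mono)
  moreover have "ent b J (block W A) \<le> real (card A) * log b (card VW)"
    by (rule ent_block_le[OF b finA VW]) (use W A in auto)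
  moreover have "real (card A) * log b (card VW) \<le> real (card A) * B"
    using cW by (auto intro: mult_left_mono)
  moreover have "r * B = real N * B - real (card A) * B" by (simp add: r_def algebra_simps)
  ultimately show False using 1 by linarith
qed

text \<open>The order may depend on the caches because caches are filled before demands are known.
  Step \<open>k\<close> already counts cache \<open>k\<close>, hence \<open>k + 1\<close> caches
  against \<open>N - k\<close> candidate files.\<close>

lemma exists_informative_order:
  fixes B m :: real
  assumes b: "1 < b" and VW: "finite VW" and VZ: "finite VZ"
    and W: "\<And>i w. i < N \<Longrightarrow> w \<in> set_pmf J \<Longrightarrow> W i w \<in> VW"
    and Z: "\<And>i w. i < s \<Longrightarrow> w \<in> set_pmf J \<Longrightarrow> Z i w \<in> VZ"
    and cW: "log b (card VW) \<le> B" and cZ: "log b (card VZ) \<le> m"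
    and full: "real N * B \<le> ent b J (block W {..<N})"
    and s: "s \<le> N"
  shows "\<exists>\<pi>. inj_on \<pi> {..<s} \<and> \<pi> ` {..<s} \<subseteq> {..<N} \<and>
    (\<forall>k<s. B - real (k + 1) * m / (real N - real k) \<le>
      ent b J (\<lambda>w. (block Z {..<k + 1} w, block W (\<pi> ` {..<k + 1}) w))
      - ent b J (\<lambda>w. (block Z {..<k + 1} w, block W (\<pi> ` {..<k}) w)))"
  using Z s
proof (induction s)
  case 0
  then show ?case by auto
next
  case (Suc s)
  have "\<exists>\<pi>. inj_on \<pi> {..<s} \<and> \<pi> ` {..<s} \<subseteq> {..<N} \<and>
    (\<forall>k<s. B - real (k + 1) * m / (real N - real k) \<le>
      ent b J (\<lambda>w. (block Z {..<k + 1} w, block W (\<pi> ` {..<k + 1}) w))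
      - ent b J (\<lambda>w. (block Z {..<k + 1} w, block W (\<pi> ` {..<k}) w)))"
    by (rule Suc.IH) (use Suc.prems in auto)
  then obtain \<pi> where \<pi>: "inj_on \<pi> {..<s}" "\<pi> ` {..<s} \<subseteq> {..<N}"
    and inc: "\<And>k. k < s \<Longrightarrow> B - real (k + 1) * m / (real N - real k) \<le>
      ent b J (\<lambda>w. (block Z {..<k + 1} w, block W (\<pi> ` {..<k + 1}) w))
      - ent b J (\<lambda>w. (block Z {..<k + 1} w, block W (\<pi> ` {..<k}) w))"
    by blast
  have card: "card (\<pi> ` {..<s}) = s" using \<pi>(1) by (simp add: card_image)
  have "\<exists>n\<in>{..<N} - \<pi> ` {..<s}. B - real (s + 1) * m / (real N - real (card (\<pi> ` {..<s}))) \<le>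
    ent b J (\<lambda>w. (block Z {..<s + 1} w, block W (insert n (\<pi> ` {..<s})) w))
     - ent b J (\<lambda>w. (block Z {..<s + 1} w, block W (\<pi> ` {..<s}) w))"
  proof (rule exists_informative_file[where W = W and Z = Z and k = "s + 1" and A = "\<pi> ` {..<s}" and N = N
        and VW = VW and VZ = VZ])
    show "Z i w \<in> VZ" if "i < s + 1" "w \<in> set_pmf J" for i w using that Suc.prems by simp
    show "card (\<pi> ` {..<s}) < N" using card Suc.prems by simp
  qed (fact b VW VZ W cW cZ full \<pi>(2))+
  then obtain n where n0: "n \<in> {..<N} - \<pi> ` {..<s}"
    "B - real (s + 1) * m / (real N - real (card (\<pi> ` {..<s}))) \<le>
      ent b J (\<lambda>w. (block Z {..<s + 1} w, block W (insert n (\<pi> ` {..<s})) w))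
       - ent b J (\<lambda>w. (block Z {..<s + 1} w, block W (\<pi> ` {..<s}) w))"
    by (rule bexE)
  note n = n0[unfolded card]
  define \<rho> where "\<rho> = \<pi>(s := n)"
  have img: "\<rho> ` {..<k} = \<pi> ` {..<k}" if "k \<le> s" for k
    using that by (intro image_cong) (auto simp: \<rho>_def)
  have img': "\<rho> ` {..<s + 1} = insert n (\<pi> ` {..<s})"
    unfolding Suc_eq_plus1[symmetric] lessThan_Suc image_insert img[OF order_refl] by (simp add: \<rho>_def)
  have "inj_on \<rho> {..<s}" using \<pi>(1) by (auto simp: \<rho>_def inj_on_def)
  then have "inj_on \<rho> {..<Suc s}"
    using n(1) unfolding lessThan_Suc inj_on_insert img[OF order_refl] by (simp add: \<rho>_def)
  moreover have "\<rho> ` {..<Suc s} \<subseteq> {..<N}" using img' n(1) \<pi>(2) by auto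
  moreover have "B - real (k + 1) * m / (real N - real k) \<le>
      ent b J (\<lambda>w. (block Z {..<k + 1} w, block W (\<rho> ` {..<k + 1}) w))
      - ent b J (\<lambda>w. (block Z {..<k + 1} w, block W (\<rho> ` {..<k}) w))" if "k < Suc s" for k
  proof (cases "k = s")
    case True
    then show ?thesis using n(2) img' img[of s] by simp
  next
    case False
    then show ?thesis using inc[of k] img[of k] img[of "k + 1"] that by simp
  qed
  ultimately show ?case by blast
qed

lemma ent_decoding_chain:
  assumes b: "1 < b" and VW: "finite VW" and VZ: "finite VZ"
    and W: "\<And>i w. i < s \<Longrightarrow> w \<in> set_pmf J \<Longrightarrow> W (\<pi> i) w \<in> VW"
    and Z: "\<And>i w. i < s \<Longrightarrow> w \<in> set_pmf J \<Longrightarrow> Z i w \<in> VZ"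
    and X: "finite (X ` set_pmf J)"
    and dec: "\<And>i w w'. i < s \<Longrightarrow> w \<in> set_pmf J \<Longrightarrow> w' \<in> set_pmf J \<Longrightarrow> X w = X w' \<Longrightarrow> Z i w = Z i w'
      \<Longrightarrow> W (\<pi> i) w = W (\<pi> i) w'"
  shows "(\<Sum>k<s. ent b J (\<lambda>w. (block Z {..<k + 1} w, block W (\<pi> ` {..<k + 1}) w))
      - ent b J (\<lambda>w. (block Z {..<k + 1} w, block W (\<pi> ` {..<k}) w))) \<le> ent b J X"
proof -
  let ?a = "\<lambda>k j. ent b J (\<lambda>w. (block Z {..<k} w, block W (\<pi> ` {..<j}) w))"
  let ?T = "\<lambda>k. ent b J (\<lambda>w. (X w, block Z {..<k} w, block W (\<pi> ` {..<k}) w))"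
  have finZ: "finite (block Z {..<k} ` set_pmf J)" if "k \<le> s" for k
    by (rule finite_block_image[OF _ VZ]) (use Z that in auto)
  have finW: "finite (block W (\<pi> ` {..<k}) ` set_pmf J)" if "k \<le> s" for k
    by (rule finite_block_image[OF _ VW]) (use W that in auto)
  \<comment> \<open>\<open>?T k - ?a k k\<close> is the entropy of \<open>X\<close> left after the
    first \<open>k\<close> caches and decoded files. Revealing cache \<open>k\<close> cannot raise
    it, and the file then decoded accounts for summand \<open>k\<close>.\<close>
  have chain: "?T k - ?a k k + (\<Sum>j<k. ?a (j + 1) (j + 1) - ?a (j + 1) j) \<le> ent b J X" if "k \<le> s" for k
    using that
  proof (induction k)
    case 0
    have "ent b J (\<lambda>w. (X w, block Z {..<0} w, block W (\<pi> ` {..<0}) w)) = ent b J X"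
      by (rule ent_cong[OF b, symmetric]) (use X in auto)
    then show ?case by (simp add: ent_const restrict_def)
  next
    case (Suc k)
    then have k: "k < s" "k \<le> s" by auto
    have Zk: "finite (Z k ` set_pmf J)"
      by (rule finite_subset[OF _ VZ]) (use Z k in auto)
    note fin = finite_pair_image[OF finZ[OF k(2)] finW[OF k(2)]]
    have "ent b J (\<lambda>w. (X w, Z k w, block Z {..<k} w, block W (\<pi> ` {..<k}) w)) + ?a k k \<le>
        ?T k + ent b J (\<lambda>w. (Z k w, block Z {..<k} w, block W (\<pi> ` {..<k}) w))"
      by (rule ent_submodular[OF b X Zk fin])
    \<comment> \<open>By \<open>dec\<close>, file \<open>\<pi> k\<close> is a function of
      \<open>X\<close> and cache \<open>k\<close>, so adding it leaves the entropy
      unchanged.\<close>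
    moreover have "ent b J (\<lambda>w. (X w, Z k w, block Z {..<k} w, block W (\<pi> ` {..<k}) w)) = ?T (k + 1)"
    proof (rule ent_cong[OF b finite_pair_image[OF X finite_pair_image[OF Zk fin]]])
      fix w w' assume "w \<in> set_pmf J" "w' \<in> set_pmf J"
      then have "X w = X w' \<and> Z k w = Z k w' \<longrightarrow> W (\<pi> k) w = W (\<pi> k) w'" using dec[OF k(1)] by blast
      then show "(X w, Z k w, block Z {..<k} w, block W (\<pi> ` {..<k}) w) =
          (X w', Z k w', block Z {..<k} w', block W (\<pi> ` {..<k}) w') \<longleftrightarrow>
        (X w, block Z {..<k + 1} w, block W (\<pi> ` {..<k + 1}) w) =
          (X w', block Z {..<k + 1} w', block W (\<pi> ` {..<k + 1}) w')"
        by (simp add: restrict_eq_iff lessThan_Suc) blast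
    qed
    moreover have "ent b J (\<lambda>w. (Z k w, block Z {..<k} w, block W (\<pi> ` {..<k}) w)) = ?a (k + 1) k"
      by (rule ent_cong[OF b finite_pair_image[OF Zk fin]]) (auto simp: restrict_eq_iff lessThan_Suc)
    ultimately show ?case using Suc.IH[OF k(2)] unfolding Suc_eq_plus1[symmetric] sum.lessThan_Suc
      by linarith
  qed
  have "?a s s \<le> ?T s"
    by (rule ent_mono[OF b finite_pair_image[OF X finite_pair_image[OF finZ finW]]]) auto
  then show ?thesis using chain[of s] by simp
qed

text \<open>\<open>J' n\<close> will be the space conditioned on user 0 demanding file
  \<open>n\<close>. There \<open>X\<close> and one cache reveal that file, so given \<open>X\<close>
  it has entropy at most \<open>m\<close>. This depends only on the law of \<open>X\<close> and the
  files, hence transfers to \<open>J\<close>, where the N uncertainties add up.\<close>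

lemma private_converse_entropy:
  fixes B m :: real
  assumes b: "1 < b" and VW: "finite VW" and VZ: "finite VZ"
    and W: "\<And>i w. i < N \<Longrightarrow> w \<in> set_pmf J \<Longrightarrow> W i w \<in> VW"
    and X: "finite (X ` set_pmf J)"
    and full: "real N * B \<le> ent b J (block W {..<N})"
    and cZ: "log b (card VZ) \<le> m"
    and Z: "\<And>n w. n < N \<Longrightarrow> w \<in> set_pmf (J' n) \<Longrightarrow> Z w \<in> VZ"
    and same_law: "\<And>n. n < N \<Longrightarrow> map_pmf (\<lambda>w. (X w, block W {..<N} w)) (J' n) =
      map_pmf (\<lambda>w. (X w, block W {..<N} w)) J"
    and dec: "\<And>n w w'. n < N \<Longrightarrow> w \<in> set_pmf (J' n) \<Longrightarrow> w' \<in> set_pmf (J' n) \<Longrightarrow> X w = X w' \<Longrightarrow> Z w = Z w'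
      \<Longrightarrow> W n w = W n w'"
  shows "real N * (B - m) \<le> ent b J X"
proof -
  let ?h = "\<lambda>J A. ent b J (\<lambda>w. (X w, block W A w))"
  have h: "ent b (J' n) (\<lambda>w. (X w, block W A w)) = ?h J A" if "n < N" "A \<subseteq> {..<N}" for n A
  proof -
    let ?f = "\<lambda>(x, v). (x, restrict v A)"
    have "ent b (J' n) (\<lambda>w. (X w, block W A w)) = ent b (map_pmf (\<lambda>w. (X w, block W {..<N} w)) (J' n)) ?f"
      using that by (simp add: ent_map_pmf Int_absorb1)
    also have "\<dots> = ?h J A"
      using that same_law by (simp add: ent_map_pmf Int_absorb1)
    finally show ?thesis .
  qed
  have finW: "finite (block W D ` set_pmf J)" if "D \<subseteq> {..<N}" for D
    by (rule finite_block_image[OF finite_subset[OF that] VW]) (use that W in auto)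
  have inc: "?h J {n} - ?h J {} \<le> m" if n: "n < N" for n
  proof -
    have "set_pmf (map_pmf (\<lambda>w. (X w, block W {..<N} w)) (J' n)) = set_pmf (map_pmf (\<lambda>w. (X w, block W {..<N} w)) J)"
      using same_law n by simp
    then have "fst ` (\<lambda>w. (X w, block W {..<N} w)) ` set_pmf (J' n) = fst ` (\<lambda>w. (X w, block W {..<N} w)) ` set_pmf J"
      by simp
    then have X': "finite (X ` set_pmf (J' n))" using X by (simp add: image_image)
    have Z': "finite (Z ` set_pmf (J' n))" by (rule finite_subset[OF _ VZ]) (use Z n in auto)
    have "?h J {n} = ?h (J' n) {n}" using h n by simp
    also have "\<dots> \<le> ent b (J' n) (\<lambda>w. (X w, Z w))"
    proof (rule ent_mono[OF b finite_pair_image[OF X' Z']])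
      fix w w' assume "w \<in> set_pmf (J' n)" "w' \<in> set_pmf (J' n)" "(X w, Z w) = (X w', Z w')"
      then have "X w = X w'" "W n w = W n w'" using dec[OF n] by blast+
      then show "(X w, block W {n} w) = (X w', block W {n} w')" by (simp add: restrict_eq_iff)
    qed
    also have "\<dots> \<le> ent b (J' n) X + ent b (J' n) Z" by (rule ent_pair_le[OF b X' Z'])
    also have "ent b (J' n) X = ?h (J' n) {}"
      by (rule ent_cong[OF b X']) auto
    also have "?h (J' n) {} = ?h J {}" using h n by simp
    also have "ent b (J' n) Z \<le> log b (card VZ)"
      by (rule ent_le_log_card[OF b VZ]) (use Z n in auto)
    finally show ?thesis using cZ by linarith
  qed
  have "?h J ({} \<union> {..<N}) - ?h J {} \<le> (\<Sum>n<N. ?h J (insert n {}) - ?h J {})"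
    by (rule ent_block_increments[OF b X VW]) (use W in auto)
  also have "\<dots> \<le> (\<Sum>n<N. m)" by (rule sum_mono) (use inc in auto)
  finally have "?h J {..<N} - ?h J {} \<le> real N * m" by simp
  moreover have "real N * B \<le> ?h J {..<N}"
    by (rule order_trans[OF full ent_mono[OF b finite_pair_image[OF X finW]]]) auto
  moreover have "ent b J X = ?h J {}" by (rule ent_cong[OF b X]) auto
  ultimately show ?thesis by (simp add: algebra_simps)
qed

section \<open>Converse bounds for demand-private coded caching\<close>

definition words :: "nat \<Rightarrow> nat \<Rightarrow> nat list set" where
  "words q n = {w. set w \<subseteq> {..<q} \<and> length w = n}"

lemma finite_words: "finite (words q n)" and card_words: "card (words q n) = q ^ n"
  by (simp_all add: words_def finite_lists_length_eq card_lists_length_eq)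

lemma log_card_words: "2 \<le> q \<Longrightarrow> log (real q) (card (words q n)) = real n"
  by (simp add: card_words log_nat_power)

lemma files_set_eq: "files_set N B q = {ws. set ws \<subseteq> words q B \<and> length ws = N}"
  by (auto simp: files_set_def words_def)

lemma finite_files_set: "finite (files_set N B q)" and card_files_set: "card (files_set N B q) = q ^ (B * N)"
  by (simp_all add: files_set_eq finite_words finite_lists_length_eq card_lists_length_eq card_words power_mult)

lemma files_set_nonempty: "2 \<le> q \<Longrightarrow> files_set N B q \<noteq> {}"
  using card_files_set[of N B q] by auto

lemma demand_set_eq: "demand_set N K = {ds. set ds \<subseteq> {..<N} \<and> length ds = K}"
  by (auto simp: demand_set_def)

lemma finite_demand_set: "finite (demand_set N K)" and card_demand_set: "card (demand_set N K) = N ^ K"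
  by (simp_all add: demand_set_eq finite_lists_length_eq card_lists_length_eq)

lemma demand_set_nonempty: "0 < N \<Longrightarrow> demand_set N K \<noteq> {}"
  using card_demand_set[of N K] by auto

lemma files_nth: "ws \<in> files_set N B q \<Longrightarrow> i < N \<Longrightarrow> ws ! i \<in> words q B"
  by (auto simp: files_set_eq)

lemma demand_nth: "ds \<in> demand_set N K \<Longrightarrow> k < K \<Longrightarrow> ds ! k < N"
  using nth_mem[of k ds] by (auto simp: demand_set_eq subset_iff)

lemma inj_on_block_files: "inj_on (block (\<lambda>i ws. ws ! i) {..<N}) (files_set N B q)"
  by (auto simp: inj_on_def restrict_eq_iff files_set_def intro: nth_equalityI)

lemma log_card_files: "2 \<le> q \<Longrightarrow> log (real q) (card (files_set N B q)) = real N * real B"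
  by (simp add: card_files_set log_nat_power)

lemma ent_files:
  assumes "2 \<le> q"
  shows "ent (real q) (pmf_of_set (files_set N B q)) (block (\<lambda>i ws. ws ! i) {..<N}) = real N * real B"
  using assms by (simp add: ent_uniform finite_files_set files_set_nonempty inj_on_block_files log_card_files)

lemma pair_pmf_of_set:
  assumes "finite A" "A \<noteq> {}" "finite B" "B \<noteq> {}"
  shows "pair_pmf (pmf_of_set A) (pmf_of_set B) = pmf_of_set (A \<times> B)"
proof (rule pmf_eqI)
  fix x :: "'a \<times> 'b"
  show "pmf (pair_pmf (pmf_of_set A) (pmf_of_set B)) x = pmf (pmf_of_set (A \<times> B)) x"
    using assms by (cases x) (simp add: pmf_pair card_cartesian_product indicator_times)
qed

text \<open>The pmf behind \<open>joint_space\<close>; \<open>ent\<close> and conditioning with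
  \<open>cond_pmf\<close> act on pmfs.\<close>

definition joint_pmf :: "nat pmf \<Rightarrow> nat \<Rightarrow> nat \<Rightarrow> nat \<Rightarrow> nat \<Rightarrow> (nat \<times> nat list list \<times> nat list) pmf" where
  "joint_pmf p N K B q =
     pair_pmf p (pair_pmf (pmf_of_set (files_set N B q)) (pmf_of_set (demand_set N K)))"

lemma joint_space_eq: "joint_space p N K B q = measure_pmf (joint_pmf p N K B q)"
  by (simp add: joint_space_def joint_pmf_def)

lemma set_joint_pmf:
  assumes "2 \<le> q" "0 < N"
  shows "set_pmf (joint_pmf p N K B q) = set_pmf p \<times> files_set N B q \<times> demand_set N K"
  using assms by (simp add: joint_pmf_def finite_files_set files_set_nonempty finite_demand_set demand_set_nonempty)

text \<open>\<open>L\<close> and \<open>m\<close> are the actual lengths of broadcast and cache, so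
  that rounding of \<open>R * B\<close> and \<open>M * B\<close> stays out of the entropy
  arguments.\<close>

locale caching_scheme =
  fixes N K q B L m :: nat and p :: "nat pmf"
    and cache :: "nat \<Rightarrow> nat \<Rightarrow> nat list list \<Rightarrow> nat list"
    and enc :: "nat \<Rightarrow> nat list \<Rightarrow> nat list list \<Rightarrow> nat list"
  assumes q: "2 \<le> q" and N: "0 < N"
    and cache: "\<And>P ws k. P \<in> set_pmf p \<Longrightarrow> ws \<in> files_set N B q \<Longrightarrow> k < K \<Longrightarrow> cache k P ws \<in> words q m"
    and enc: "\<And>P ws ds. P \<in> set_pmf p \<Longrightarrow> ws \<in> files_set N B q \<Longrightarrow> ds \<in> demand_set N K
      \<Longrightarrow> enc P ds ws \<in> words q L"
    and correct: "\<And>k. k < K \<Longrightarrow> cond_entropy (joint_space p N K B q) (real q)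
          (\<lambda>(P, ws, ds). ws ! (ds ! k)) (\<lambda>(P, ws, ds). (enc P ds ws, ds ! k, cache k P ws)) = 0"
    and privacy: "\<And>S. S \<noteq> {} \<Longrightarrow> S \<subseteq> {..<K} \<Longrightarrow>
          cond_mutual_info (joint_space p N K B q) (real q)
            (\<lambda>(P, ws, ds). restrict (\<lambda>k. ds ! k) ({..<K} - S))
            (\<lambda>(P, ws, ds). (enc P ds ws, restrict (\<lambda>k. ds ! k) S, restrict (\<lambda>k. cache k P ws) S))
            (\<lambda>(P, ws, ds). ws) = 0"
begin

abbreviation "J \<equiv> joint_pmf p N K B q"

lemma b: "1 < real q" using q by simp

lemma set_J: "set_pmf J = set_pmf p \<times> files_set N B q \<times> demand_set N K"
  using q N by (rule set_joint_pmf)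

text \<open>Files and demands are uniform, so every combination with \<open>P\<close> in the support
  has positive probability. Average correctness thus becomes correctness in every case, even across
  different values of the server randomness.\<close>

lemma decode:
  assumes k: "k < K" and P: "P \<in> set_pmf p" "P' \<in> set_pmf p"
    and ws: "ws \<in> files_set N B q" "ws' \<in> files_set N B q"
    and ds: "ds \<in> demand_set N K" "ds' \<in> demand_set N K"
    and eq: "enc P ds ws = enc P' ds' ws'" "ds ! k = ds' ! k" "cache k P ws = cache k P' ws'"
  shows "ws ! (ds ! k) = ws' ! (ds' ! k)"
proof -
  let ?X = "\<lambda>(P :: nat, ws, ds). ws ! (ds ! k) :: nat list"
    and ?Y = "\<lambda>(P, ws, ds). (enc P ds ws, ds ! k, cache k P ws)"
  have X: "finite (?X ` set_pmf J)"
    by (rule finite_subset[OF _ finite_words[of q B]]) (use k in \<open>auto simp: set_J intro!: files_nth demand_nth\<close>)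
  have Y: "finite (?Y ` set_pmf J)"
    by (rule finite_subset[of _ "words q L \<times> {..<N} \<times> words q m"])
      (use k cache enc in \<open>auto simp: set_J finite_words demand_nth\<close>)
  have "?X (P, ws, ds) = ?X (P', ws', ds')"
    by (rule cond_entropy_zero_imp_determined[OF b X Y correct[OF k, unfolded joint_space_eq]])
      (use assms in \<open>auto simp: set_J\<close>)
  then show ?thesis by simp
qed

lemma cut_set_bound:
  assumes s: "s \<le> N" "s \<le> K"
  shows "(\<Sum>k<s. real B - real (k + 1) * real m / (real N - real k)) \<le> real L"
proof -
  \<comment> \<open>One value of the randomness is fixed; by \<open>decode\<close> the result is a
    deterministic scheme on uniform files that still decodes.\<close>
  obtain P where P: "P \<in> set_pmf p" using set_pmf_not_empty[of p] by auto
  let ?J = "pmf_of_set (files_set N B q)"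
  define W where "W = (\<lambda>i (ws :: nat list list). ws ! i)"
  define Z where "Z = (\<lambda>i. cache i P)"
  have setJ: "set_pmf ?J = files_set N B q"
    using q by (simp add: finite_files_set files_set_nonempty)
  have W: "W i ws \<in> words q B" if "i < N" "ws \<in> set_pmf ?J" for i ws
    using that files_nth by (simp add: W_def setJ)
  have Z: "Z i ws \<in> words q m" if "i < s" "ws \<in> set_pmf ?J" for i ws
    using that s P cache by (simp add: Z_def setJ)
  have full: "real N * real B \<le> ent (real q) ?J (block W {..<N})"
    using ent_files[OF q, of N B] by (simp add: W_def)
  obtain \<pi> where \<pi>: "inj_on \<pi> {..<s}" "\<pi> ` {..<s} \<subseteq> {..<N}"
    and inc: "\<And>k. k < s \<Longrightarrow> real B - real (k + 1) * real m / (real N - real k) \<le>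
      ent (real q) ?J (\<lambda>w. (block Z {..<k + 1} w, block W (\<pi> ` {..<k + 1}) w))
      - ent (real q) ?J (\<lambda>w. (block Z {..<k + 1} w, block W (\<pi> ` {..<k}) w))"
    using exists_informative_order[where W = W and Z = Z and s = s and N = N and J = ?J,
        OF b finite_words finite_words W Z eq_refl[OF log_card_words[OF q]] eq_refl[OF log_card_words[OF q]] full s(1)]
    by blast
  \<comment> \<open>Users from \<open>s\<close> on get the placeholder demand 0, a legal index
    because N > 0.\<close>
  define ds where "ds = map (\<lambda>k. if k < s then \<pi> k else 0) [0..<K]"
  have ds: "ds \<in> demand_set N K" using \<pi>(2) N by (auto simp: ds_def demand_set_def)
  have ds_nth: "ds ! k = \<pi> k" if "k < s" for k using that s by (simp add: ds_def)
  define X where "X = enc P ds"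
  have XL: "X ` set_pmf ?J \<subseteq> words q L" using enc P ds by (auto simp: X_def setJ)
  have "(\<Sum>k<s. real B - real (k + 1) * real m / (real N - real k)) \<le>
    (\<Sum>k<s. ent (real q) ?J (\<lambda>w. (block Z {..<k + 1} w, block W (\<pi> ` {..<k + 1}) w))
      - ent (real q) ?J (\<lambda>w. (block Z {..<k + 1} w, block W (\<pi> ` {..<k}) w)))"
    by (rule sum_mono) (use inc in auto)
  also have "\<dots> \<le> ent (real q) ?J X"
  proof (rule ent_decoding_chain[OF b finite_words finite_words])
    show "W (\<pi> i) w \<in> words q B" if "i < s" "w \<in> set_pmf ?J" for i w using W \<pi>(2) that by auto
    show "Z i w \<in> words q m" if "i < s" "w \<in> set_pmf ?J" for i w using Z that .
    show "finite (X ` set_pmf ?J)" using finite_subset[OF XL finite_words] .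
    show "W (\<pi> i) w = W (\<pi> i) w'"
      if "i < s" "w \<in> set_pmf ?J" "w' \<in> set_pmf ?J" "X w = X w'" "Z i w = Z i w'" for i w w'
      using decode[of i P P w w' ds ds] that s P ds ds_nth[of i] by (simp add: X_def W_def Z_def setJ)
  qed
  also have "\<dots> \<le> log (real q) (card (words q L))"
    by (rule ent_le_log_card[OF b finite_words XL])
  finally show ?thesis by (simp add: log_card_words[OF q])
qed

end

section \<open>The privacy bound\<close>

lemma ent_cond_info_mono:
  assumes b: "1 < b" and X: "finite (X ` set_pmf J)" and Y: "finite (Y ` set_pmf J)" and Z: "finite (Z ` set_pmf J)"
  shows "ent b J (\<lambda>w. (f (X w), Z w)) + ent b J (\<lambda>w. (g (Y w), Z w)) - ent b J (\<lambda>w. (f (X w), g (Y w), Z w)) \<le>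
    ent b J (\<lambda>w. (X w, Z w)) + ent b J (\<lambda>w. (Y w, Z w)) - ent b J (\<lambda>w. (X w, Y w, Z w))"
proof -
  have fX: "finite ((\<lambda>w. f (X w)) ` set_pmf J)" using finite_imageI[OF X, of f] by (simp add: image_image)
  have gY: "finite ((\<lambda>w. g (Y w)) ` set_pmf J)" using finite_imageI[OF Y, of g] by (simp add: image_image)
  \<comment> \<open>Data processing in two moves, first from \<open>X\<close> to its image under
    \<open>f\<close>, then from \<open>Y\<close> to its image under \<open>g\<close>. Each move is
    one submodularity; \<open>ent_cong\<close> absorbs the inserted function values.\<close>
  have "ent b J (\<lambda>w. (X w, Y w, f (X w), Z w)) + ent b J (\<lambda>w. (f (X w), Z w)) \<le>
      ent b J (\<lambda>w. (X w, f (X w), Z w)) + ent b J (\<lambda>w. (Y w, f (X w), Z w))"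
    by (rule ent_submodular[OF b X Y finite_pair_image[OF fX Z]])
  moreover have "ent b J (\<lambda>w. (X w, Y w, f (X w), Z w)) = ent b J (\<lambda>w. (X w, Y w, Z w))"
    by (rule ent_cong[OF b finite_pair_image[OF X finite_pair_image[OF Y finite_pair_image[OF fX Z]]]]) auto
  moreover have "ent b J (\<lambda>w. (X w, f (X w), Z w)) = ent b J (\<lambda>w. (X w, Z w))"
    by (rule ent_cong[OF b finite_pair_image[OF X finite_pair_image[OF fX Z]]]) auto
  moreover have "ent b J (\<lambda>w. (Y w, f (X w), g (Y w), Z w)) + ent b J (\<lambda>w. (g (Y w), Z w)) \<le>
      ent b J (\<lambda>w. (Y w, g (Y w), Z w)) + ent b J (\<lambda>w. (f (X w), g (Y w), Z w))"
    by (rule ent_submodular[OF b Y fX finite_pair_image[OF gY Z]])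
  moreover have "ent b J (\<lambda>w. (Y w, f (X w), g (Y w), Z w)) = ent b J (\<lambda>w. (Y w, f (X w), Z w))"
    by (rule ent_cong[OF b finite_pair_image[OF Y finite_pair_image[OF fX finite_pair_image[OF gY Z]]]]) auto
  moreover have "ent b J (\<lambda>w. (Y w, g (Y w), Z w)) = ent b J (\<lambda>w. (Y w, Z w))"
    by (rule ent_cong[OF b finite_pair_image[OF Y finite_pair_image[OF gY Z]]]) auto
  ultimately show ?thesis by linarith
qed

lemma map_pmf_cond_indep:
  assumes ne: "set_pmf J \<inter> D -` {n} \<noteq> {}"
    and indep: "\<And>v. pmf (map_pmf (\<lambda>w. (D w, F w)) J) (n, v) = pmf (map_pmf D J) n * pmf (map_pmf F J) v"
  shows "map_pmf F (cond_pmf J (D -` {n})) = map_pmf F J"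
proof (rule pmf_eqI)
  fix v
  let ?E = "D -` {n}"
  have "measure J ?E \<noteq> 0" using ne by (simp add: measure_pmf_zero_iff)
  moreover have "measure (cond_pmf J ?E) (F -` {v}) = measure J (?E \<inter> F -` {v}) / measure J ?E"
    unfolding cond_pmf.rep_eq[OF ne] using emeasure_measure_pmf_not_zero[OF ne]
    by (subst measure_uniform_measure) (auto simp: measure_pmf.emeasure_eq_measure)
  moreover have "?E \<inter> F -` {v} = (\<lambda>w. (D w, F w)) -` {(n, v)}" by auto
  ultimately show "pmf (map_pmf F (cond_pmf J ?E)) v = pmf (map_pmf F J) v"
    using indep[of v] by (simp add: pmf_map)
qed

context caching_scheme begin

lemma demand_files_indep:
  assumes "k < K"
  shows "pmf (map_pmf (\<lambda>(P, ws, ds). (ds ! k, ws)) J) (n, w) =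
    pmf (map_pmf (\<lambda>(P, ws, ds). ds ! k) J) n * pmf (map_pmf (\<lambda>(P, ws, ds). ws) J) w"
proof -
  let ?F = "pmf_of_set (files_set N B q)" and ?D = "pmf_of_set (demand_set N K)"
  have snd: "map_pmf (\<lambda>(P, ws, ds). f ws ds) J = map_pmf (\<lambda>(ws, ds). f ws ds) (pair_pmf ?F ?D)" for f :: "_ \<Rightarrow> _ \<Rightarrow> 'x"
  proof -
    have "map_pmf (\<lambda>(ws, ds). f ws ds) (map_pmf snd J) = map_pmf (\<lambda>(P, ws, ds). f ws ds) J"
      by (simp add: pmf.map_comp comp_def case_prod_unfold)
    then show ?thesis by (simp add: joint_pmf_def map_snd_pair_pmf)
  qed
  have 1: "map_pmf (\<lambda>(P, ws, ds). ds ! k) J = map_pmf (\<lambda>ds. ds ! k) ?D"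
  proof -
    have "map_pmf (\<lambda>ds. ds ! k) (map_pmf snd (pair_pmf ?F ?D)) = map_pmf (\<lambda>(ws, ds). ds ! k) (pair_pmf ?F ?D)"
      by (simp only: pmf.map_comp comp_def case_prod_unfold)
    then show ?thesis by (simp add: snd map_snd_pair_pmf)
  qed
  have 2: "map_pmf (\<lambda>(P, ws, ds). ws) J = ?F"
  proof -
    have "map_pmf fst (pair_pmf ?F ?D) = map_pmf (\<lambda>(ws, ds). ws) (pair_pmf ?F ?D)"
      by (simp add: case_prod_unfold)
    then show ?thesis by (simp add: snd map_fst_pair_pmf)
  qed
  have "pmf (map_pmf (\<lambda>(P, ws, ds). (ds ! k, ws)) J) (n, w) =
      measure (pair_pmf ?F ?D) ({w} \<times> (\<lambda>ds. ds ! k) -` {n})"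
    unfolding snd pmf_map by (rule arg_cong[where f = "measure _"]) auto
  also have "\<dots> = measure ?F {w} * measure ?D ((\<lambda>ds. ds ! k) -` {n})"
    by (rule measure_pmf_prob_product) auto
  finally show ?thesis by (simp add: 1 2 pmf_map measure_pmf_single)
qed

text \<open>Privacy against user 1 hides the demand of user 0, which is where a second user is
  needed. Data processing leaves zero information between that demand and the broadcast given the
  files; since the demand is also independent of the files, conditional independence becomes
  independence.\<close>

lemma broadcast_demand_indep:
  assumes K: "2 \<le> K"
  shows "pmf (map_pmf (\<lambda>(P, ws, ds). (ds ! 0, enc P ds ws, ws)) J) (n, x, w) =
    pmf (map_pmf (\<lambda>(P, ws, ds). ds ! 0) J) n * pmf (map_pmf (\<lambda>(P, ws, ds). (enc P ds ws, ws)) J) (x, w)"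
proof -
  define X where "X = (\<lambda>(P :: nat, ws :: nat list list, ds). restrict (\<lambda>k. ds ! k :: nat) ({..<K} - {1}))"
  define Y where "Y = (\<lambda>(P, ws, ds). (enc P ds ws, restrict (\<lambda>k. ds ! k :: nat) {1}, restrict (\<lambda>k. cache k P ws) {1}))"
  define W where "W = (\<lambda>(P :: nat, ws :: nat list list, ds :: nat list). ws)"
  \<comment> \<open>\<open>f\<close> extracts the demand of user 0 from the hidden demands, and
    \<open>g\<close> the broadcast from everything user 1 observes.\<close>
  define f where "f = (\<lambda>r :: nat \<Rightarrow> nat. r 0)"
  define g where "g = (\<lambda>(x :: nat list, y :: nat \<Rightarrow> nat, z :: nat \<Rightarrow> nat list). x)"
  have X: "finite (X ` set_pmf J)"
  proof -
    have "X = block (\<lambda>k (P, ws, ds). ds ! k) ({..<K} - {1})" by (auto simp: X_def fun_eq_iff)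
    moreover have "finite (block (\<lambda>k (P, ws, ds). ds ! k) ({..<K} - {1}) ` set_pmf J)"
      by (rule finite_block_image[of _ "{..<N}"]) (auto simp: set_J demand_nth)
    ultimately show ?thesis by simp
  qed
  have Y: "finite (Y ` set_pmf J)"
  proof -
    have "Y = (\<lambda>w. (case w of (P, ws, ds) \<Rightarrow> enc P ds ws, block (\<lambda>k (P, ws, ds). ds ! k) {1} w,
        block (\<lambda>k (P, ws, ds). cache k P ws) {1} w))"
      by (auto simp: Y_def fun_eq_iff)
    moreover have "finite (\<dots> ` set_pmf J)"
    proof (intro finite_pair_image)
      show "finite ((\<lambda>w. case w of (P, ws, ds) \<Rightarrow> enc P ds ws) ` set_pmf J)"
        by (rule finite_subset[OF _ finite_words[of q L]]) (auto simp: set_J enc)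
      show "finite (block (\<lambda>k (P, ws, ds). ds ! k) {1} ` set_pmf J)"
        by (rule finite_block_image[of _ "{..<N}"]) (use K in \<open>auto simp: set_J demand_nth\<close>)
      show "finite (block (\<lambda>k (P, ws, ds). cache k P ws) {1} ` set_pmf J)"
        by (rule finite_block_image[of _ "words q m"]) (use K in \<open>auto simp: set_J cache finite_words\<close>)
    qed
    ultimately show ?thesis by simp
  qed
  have W: "finite (W ` set_pmf J)"
    by (rule finite_subset[OF _ finite_files_set[of N B q]]) (auto simp: W_def set_J)
  have f: "(\<lambda>w. f (X w)) = (\<lambda>(P, ws, ds). ds ! 0)" using K by (auto simp: f_def X_def)
  have g: "(\<lambda>w. g (Y w)) = (\<lambda>(P, ws, ds). enc P ds ws)" by (auto simp: g_def Y_def)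
  have fX: "finite ((\<lambda>w. f (X w)) ` set_pmf J)" using finite_imageI[OF X, of f] by (simp add: image_image)
  have gY: "finite ((\<lambda>w. g (Y w)) ` set_pmf J)" using finite_imageI[OF Y, of g] by (simp add: image_image)
  have "cond_mutual_info (measure_pmf J) (real q) X Y W = 0"
    using privacy[of "{1}"] K by (simp add: joint_space_eq X_def Y_def W_def)
  then have "ent (real q) J (\<lambda>w. (f (X w), W w)) + ent (real q) J (\<lambda>w. (g (Y w), W w))
      - ent (real q) J (\<lambda>w. (f (X w), g (Y w), W w)) \<le> ent (real q) J W"
    using ent_cond_info_mono[OF b X Y W, of f g] cond_mutual_info_eq_ent[OF b X Y W] by linarith
  then have "ent (real q) J (\<lambda>w. (f (X w), g (Y w), W w)) + ent (real q) J W =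
      ent (real q) J (\<lambda>w. (f (X w), W w)) + ent (real q) J (\<lambda>w. (g (Y w), W w))"
    using ent_submodular[OF b fX gY W] by linarith
  note indep = ent_modular_imp_cond_indep[OF b fX gY W this, of n x w]
  have fg: "(\<lambda>\<omega>. (f (X \<omega>), g (Y \<omega>), W \<omega>)) = (\<lambda>(P, ws, ds). (ds ! 0, enc P ds ws, ws))"
      "(\<lambda>\<omega>. (f (X \<omega>), W \<omega>)) = (\<lambda>(P, ws, ds). (ds ! 0, ws))"
      "(\<lambda>\<omega>. (g (Y \<omega>), W \<omega>)) = (\<lambda>(P, ws, ds). (enc P ds ws, ws))"
    using f g by (auto simp: fun_eq_iff W_def)
  show ?thesis
  \<comment> \<open>The mass of \<open>w\<close> is to be cancelled; if it is zero, both joint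
    masses vanish with it.\<close>
  proof (cases "pmf (map_pmf W J) w = 0")
    case True
    have "pmf (map_pmf (\<lambda>(P, ws, ds). (ds ! 0, enc P ds ws, ws)) J) (n, x, w) \<le> pmf (map_pmf W J) w"
      by (rule pmf_map_mono) (auto simp: W_def)
    moreover have "pmf (map_pmf (\<lambda>(P, ws, ds). (enc P ds ws, ws)) J) (x, w) \<le> pmf (map_pmf W J) w"
      by (rule pmf_map_mono) (auto simp: W_def)
    ultimately have "pmf (map_pmf (\<lambda>(P, ws, ds). (ds ! 0, enc P ds ws, ws)) J) (n, x, w) = 0"
      "pmf (map_pmf (\<lambda>(P, ws, ds). (enc P ds ws, ws)) J) (x, w) = 0"
      unfolding True by (auto intro: antisym)
    then show ?thesis by simp
  next
    case False
    have "pmf (map_pmf (\<lambda>(P, ws, ds). (ds ! 0, ws)) J) (n, w) =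
      pmf (map_pmf (\<lambda>(P, ws, ds). ds ! 0) J) n * pmf (map_pmf W J) w"
      unfolding W_def by (rule demand_files_indep) (use K in simp)
    with indep show ?thesis using False unfolding fg by simp
  qed
qed

lemma private_bound:
  assumes K: "2 \<le> K"
  shows "real N * (real B - real m) \<le> real L"
proof -
  let ?D = "\<lambda>(P :: nat, ws :: nat list list, ds). ds ! 0 :: nat"
  define X where "X = (\<lambda>(P, ws, ds). enc P ds ws)"
  define Z where "Z = (\<lambda>(P, ws, ds :: nat list). cache 0 P ws)"
  define W where "W = (\<lambda>i (P :: nat, ws :: nat list list, ds :: nat list). ws ! i)"
  define J' where "J' n = cond_pmf J (?D -` {n})" for n
  have ne: "set_pmf J \<inter> ?D -` {n} \<noteq> {}" if n: "n < N" for n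
  proof -
    obtain P ws where "P \<in> set_pmf p" "ws \<in> files_set N B q"
      using set_pmf_not_empty[of p] files_set_nonempty[OF q] by blast
    moreover have "replicate K n \<in> demand_set N K" using n by (auto simp: demand_set_def)
    ultimately have "(P, ws, replicate K n) \<in> set_pmf J \<inter> ?D -` {n}" using K by (simp add: set_J)
    then show ?thesis by blast
  qed
  have setJ': "set_pmf (J' n) = set_pmf J \<inter> ?D -` {n}" if "n < N" for n
    unfolding J'_def by (rule set_cond_pmf[OF ne[OF that]])
  have XL: "X ` set_pmf J \<subseteq> words q L" using enc by (auto simp: X_def set_J)
  have law: "map_pmf (\<lambda>w. (X w, block W {..<N} w)) (J' n) = map_pmf (\<lambda>w. (X w, block W {..<N} w)) J"
    if n: "n < N" for n
  proof -
    let ?F = "\<lambda>(P, ws, ds). (enc P ds ws, ws)"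
    let ?h = "\<lambda>(x :: nat list, ws :: nat list list). (x, restrict (\<lambda>i. ws ! i) {..<N})"
    have h: "(\<lambda>w. (X w, block W {..<N} w)) = ?h \<circ> ?F" by (auto simp: X_def W_def fun_eq_iff)
    have "map_pmf ?F (cond_pmf J (?D -` {n})) = map_pmf ?F J"
    proof (rule map_pmf_cond_indep[OF ne[OF n]])
      fix v
      have "(\<lambda>w. (?D w, ?F w)) = (\<lambda>(P, ws, ds). (ds ! 0, enc P ds ws, ws))" by (auto simp: fun_eq_iff)
      then show "pmf (map_pmf (\<lambda>w. (?D w, ?F w)) J) (n, v) = pmf (map_pmf ?D J) n * pmf (map_pmf ?F J) v"
        using broadcast_demand_indep[OF K, of n "fst v" "snd v"] by simp
    qed
    then show ?thesis unfolding J'_def h pmf.map_comp[symmetric] by simp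
  qed
  have full: "real N * real B \<le> ent (real q) J (block W {..<N})"
  proof -
    have "map_pmf fst (map_pmf snd J) = pmf_of_set (files_set N B q)"
      by (simp add: joint_pmf_def map_snd_pair_pmf map_fst_pair_pmf)
    then have "ent (real q) (map_pmf fst (map_pmf snd J)) (block (\<lambda>i ws. ws ! i) {..<N}) = real N * real B"
      using ent_files[OF q, of N B] by simp
    moreover have "(\<lambda>w. block (\<lambda>i ws. ws ! i) {..<N} (fst (snd w))) = block W {..<N}"
      by (auto simp: W_def fun_eq_iff)
    ultimately show ?thesis by (simp add: ent_map_pmf)
  qed
  have "real N * (real B - real m) \<le> ent (real q) J X"
  proof (rule private_converse_entropy[where J' = J' and W = W and X = X and Z = Z,
        OF b finite_words finite_words _ _ full eq_refl[OF log_card_words[OF q]] _ law])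
    show "W i w \<in> words q B" if "i < N" "w \<in> set_pmf J" for i w
      using that by (auto simp: W_def set_J files_nth)
    show "finite (X ` set_pmf J)" using finite_subset[OF XL finite_words] .
    show "Z w \<in> words q m" if "n < N" "w \<in> set_pmf (J' n)" for n w
      using that cache K unfolding setJ'[OF that(1)] by (auto simp: Z_def set_J)
    show "W n w = W n w'"
      if "n < N" "w \<in> set_pmf (J' n)" "w' \<in> set_pmf (J' n)" "X w = X w'" "Z w = Z w'" for n w w'
    proof -
      obtain P ws ds P' ws' ds' where w: "w = (P, ws, ds)" "w' = (P', ws', ds')" by (metis prod_cases3)
      then have "ws ! (ds ! 0) = ws' ! (ds' ! 0)"
        using that K unfolding setJ'[OF that(1)]
        by (intro decode[of 0 P P']) (auto simp: set_J X_def Z_def)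
      then show ?thesis using that unfolding setJ'[OF that(1)] by (auto simp: w W_def)
    qed
  qed
  also have "\<dots> \<le> log (real q) (card (words q L))"
    by (rule ent_le_log_card[OF b finite_words XL])
  finally show ?thesis by (simp add: log_card_words[OF q])
qed

end

section \<open>From single schemes to the optimal load\<close>

lemma achievable_imp_scheme:
  assumes "2 \<le> q" "0 < N" and "achievable N K q M R B"
  obtains p cache enc where "caching_scheme N K q B (nat \<lceil>R * real B\<rceil>) (nat \<lfloor>M * real B\<rfloor>) p cache enc"
proof -
  obtain p cache enc where
    cache: "\<forall>P\<in>set_pmf p. \<forall>ws\<in>files_set N B q. \<forall>k<K.
          length (cache k P ws) = nat \<lfloor>M * real B\<rfloor> \<and> set (cache k P ws) \<subseteq> {..<q}"
    and enc: "\<forall>P\<in>set_pmf p. \<forall>ws\<in>files_set N B q. \<forall>ds\<in>demand_set N K.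
          length (enc P ds ws) = nat \<lceil>R * real B\<rceil> \<and> set (enc P ds ws) \<subseteq> {..<q}"
    and rest: "\<forall>k<K. cond_entropy (joint_space p N K B q) (real q)
          (\<lambda>(P, ws, ds). ws ! (ds ! k)) (\<lambda>(P, ws, ds). (enc P ds ws, ds ! k, cache k P ws)) = 0"
      "\<forall>S. S \<noteq> {} \<longrightarrow> S \<subseteq> {..<K} \<longrightarrow>
          cond_mutual_info (joint_space p N K B q) (real q)
            (\<lambda>(P, ws, ds). restrict (\<lambda>k. ds ! k) ({..<K} - S))
            (\<lambda>(P, ws, ds). (enc P ds ws, restrict (\<lambda>k. ds ! k) S, restrict (\<lambda>k. cache k P ws) S))
            (\<lambda>(P, ws, ds). ws) = 0"
    using assms(3) unfolding achievable_def by (elim exE conjE) (rule that)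
  show ?thesis
  proof (rule that, unfold_locales)
    fix P ws k assume "P \<in> set_pmf p" "ws \<in> files_set N B q" "k < K"
    then show "cache k P ws \<in> words q (nat \<lfloor>M * real B\<rfloor>)" using cache by (simp add: words_def)
  next
    fix P ws ds assume "P \<in> set_pmf p" "ws \<in> files_set N B q" "ds \<in> demand_set N K"
    then show "enc P ds ws \<in> words q (nat \<lceil>R * real B\<rceil>)" using enc by (simp add: words_def)
  qed (use assms(1,2) rest in blast)+
qed

text \<open>Rounding the cache size down only strengthens the bound. Rounding the broadcast length
  up costs the \<open>+ 1\<close>, which disappears after division by \<open>B\<close> in the
  limit.\<close>

lemma achievable_cut_set:
  assumes q: "2 \<le> q" and N: "0 < N" and ach: "achievable N K q M R B" and MR: "0 \<le> M" "0 \<le> R"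
    and s: "s \<le> N" "s \<le> K"
  shows "real B * (real s - M * (\<Sum>k<s. real (k + 1) / (real N - real k))) \<le> R * real B + 1"
proof -
  obtain p cache enc where "caching_scheme N K q B (nat \<lceil>R * real B\<rceil>) (nat \<lfloor>M * real B\<rfloor>) p cache enc"
    using achievable_imp_scheme[OF q N ach] .
  then interpret caching_scheme N K q B "nat \<lceil>R * real B\<rceil>" "nat \<lfloor>M * real B\<rfloor>" p cache enc .
  have m: "real (nat \<lfloor>M * real B\<rfloor>) \<le> M * real B" using MR by simp
  have "real B * (real s - M * (\<Sum>k<s. real (k + 1) / (real N - real k))) =
      (\<Sum>k<s. real B - real (k + 1) * (M * real B) / (real N - real k))"
    by (simp add: sum_subtractf sum_distrib_left algebra_simps)
  also have "\<dots> \<le> (\<Sum>k<s. real B - real (k + 1) * real (nat \<lfloor>M * real B\<rfloor>) / (real N - real k))"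
    by (intro sum_mono diff_left_mono divide_right_mono mult_left_mono m) (use s in auto)
  also have "\<dots> \<le> real (nat \<lceil>R * real B\<rceil>)" by (rule cut_set_bound[OF s])
  also have "\<dots> \<le> R * real B + 1" using MR by simp
  finally show ?thesis .
qed

lemma achievable_private:
  assumes q: "2 \<le> q" and N: "0 < N" and K: "2 \<le> K" and ach: "achievable N K q M R B" and MR: "0 \<le> M" "0 \<le> R"
  shows "real B * (real N * (1 - M)) \<le> R * real B + 1"
proof -
  obtain p cache enc where "caching_scheme N K q B (nat \<lceil>R * real B\<rceil>) (nat \<lfloor>M * real B\<rfloor>) p cache enc"
    using achievable_imp_scheme[OF q N ach] .
  then interpret caching_scheme N K q B "nat \<lceil>R * real B\<rceil>" "nat \<lfloor>M * real B\<rfloor>" p cache enc .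
  have m: "real (nat \<lfloor>M * real B\<rfloor>) \<le> M * real B" using MR by simp
  have "real B * (real N * (1 - M)) = real N * (real B - M * real B)" by (simp add: algebra_simps)
  also have "\<dots> \<le> real N * (real B - real (nat \<lfloor>M * real B\<rfloor>))"
    using m by (intro mult_left_mono) auto
  also have "\<dots> \<le> real (nat \<lceil>R * real B\<rceil>)" by (rule private_bound[OF K])
  also have "\<dots> \<le> R * real B + 1" using MR by simp
  finally show ?thesis .
qed

text \<open>Broadcasting all files shows that the infimum in the definition of \<^const>\<open>R_opt\<close> ranges over a
  nonempty set; on an empty set it would be an unspecified real number.\<close>

lemma achievable_broadcast_all:
  assumes q: "2 \<le> q" and N: "0 < N"
  shows "achievable N K q M (real N) B"
proof -
  define p :: "nat pmf" where "p = return_pmf 0"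
  define m where "m = nat \<lfloor>M * real B\<rfloor>"
  define cache where "cache = (\<lambda>(k :: nat) (P :: nat) (ws :: nat list list). replicate m (0 :: nat))"
  define enc where "enc = (\<lambda>(P :: nat) (ds :: nat list) (ws :: nat list list). concat ws)"
  let ?J = "joint_pmf p N K B q"
  have b: "1 < real q" using q by simp
  have setJ: "set_pmf ?J = {0} \<times> files_set N B q \<times> demand_set N K"
    using set_joint_pmf[OF q N, of p K B] by (simp add: p_def)
  have finJ: "finite (f ` set_pmf ?J)" for f :: "_ \<Rightarrow> 'x"
    by (simp add: setJ finite_files_set finite_demand_set)
  have len: "length (concat ws) = N * B" if "ws \<in> files_set N B q" for ws
  proof -
    have "map length ws = replicate N B" using that by (auto simp: files_set_def intro!: nth_equalityI)
    then show ?thesis by (simp add: length_concat sum_list_replicate)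
  qed
  have inj: "ws = ws'" if "ws \<in> files_set N B q" "ws' \<in> files_set N B q" "concat ws = concat ws'" for ws ws'
  proof (rule concat_injective[OF that(3)])
    show "length ws = length ws'" using that by (simp add: files_set_def)
    show "\<forall>(x, y)\<in>set (zip ws ws'). length x = length y"
    proof clarify
      fix x y assume "(x, y) \<in> set (zip ws ws')"
      then have "x \<in> set ws" "y \<in> set ws'" by (auto dest: set_zip_leftD set_zip_rightD)
      then show "length x = length y" using that by (simp add: files_set_def)
    qed
  qed
  have corr: "cond_entropy (joint_space p N K B q) (real q) (\<lambda>(P, ws, ds). ws ! (ds ! k))
      (\<lambda>(P, ws, ds). (enc P ds ws, ds ! k, cache k P ws)) = 0" for k
    unfolding joint_space_eq cond_entropy_eq_ent[OF b finJ finJ] right_minus_eq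
    by (rule ent_cong[OF b finJ]) (auto simp: setJ enc_def dest: inj)
  \<comment> \<open>The encoder ignores the demands, so beyond the files the users in
    \<open>S\<close> see only their own demands. Files and demands are jointly uniform, so their
    entropy attains the sum of the upper bounds for the parts; together with submodularity this
    squeezes the mutual information to zero.\<close>
  have priv: "cond_mutual_info (joint_space p N K B q) (real q)
      (\<lambda>(P, ws, ds). restrict (\<lambda>k. ds ! k) ({..<K} - S))
      (\<lambda>(P, ws, ds). (enc P ds ws, restrict (\<lambda>k. ds ! k) S, restrict (\<lambda>k. cache k P ws) S))
      (\<lambda>(P, ws, ds). ws) = 0" if S: "S \<subseteq> {..<K}" for S
  proof -
    define W where "W = (\<lambda>(P :: nat, ws :: nat list list, ds :: nat list). ws)"
    define d where "d = (\<lambda>i (P :: nat, ws :: nat list list, ds :: nat list). ds ! i)"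
    let ?Y = "\<lambda>(P, ws, ds). (enc P ds ws, restrict (\<lambda>k. ds ! k) S, restrict (\<lambda>k. cache k P ws) S)"
    let ?X = "block d ({..<K} - S)" and ?S = "block d S"
    have X: "?X = (\<lambda>(P, ws, ds). restrict (\<lambda>k. ds ! k) ({..<K} - S))" by (auto simp: d_def fun_eq_iff)
    have YW: "ent (real q) ?J (\<lambda>w. (?Y w, W w)) = ent (real q) ?J (\<lambda>w. (?S w, W w))"
      by (rule ent_cong[OF b finJ]) (auto simp: W_def d_def enc_def cache_def)
    have XYW: "ent (real q) ?J (\<lambda>w. (?X w, ?Y w, W w)) = ent (real q) ?J (\<lambda>w. (?X w, ?S w, W w))"
      by (rule ent_cong[OF b finJ]) (auto simp: W_def d_def enc_def cache_def)
    have sm: "ent (real q) ?J (\<lambda>w. (?X w, ?S w, W w)) + ent (real q) ?J W \<le>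
        ent (real q) ?J (\<lambda>w. (?X w, W w)) + ent (real q) ?J (\<lambda>w. (?S w, W w))"
      by (rule ent_submodular[OF b finJ finJ finJ])
    have dW: "ent (real q) ?J (\<lambda>w. (block d A w, W w)) \<le> real (card A) * log (real q) (real N) + ent (real q) ?J W"
      if "A \<subseteq> {..<K}" for A
    proof -
      have "ent (real q) ?J (block d A) \<le> real (card A) * log (real q) (card {..<N})"
        by (rule ent_block_le[OF b finite_subset[OF that]]) (use that in \<open>auto simp: d_def setJ demand_nth\<close>)
      then show ?thesis using ent_pair_le[OF b finJ finJ, of "block d A" W] by simp
    qed
    have mJ: "map_pmf snd ?J = pmf_of_set (files_set N B q \<times> demand_set N K)"
      using q N by (simp add: joint_pmf_def map_snd_pair_pmf pair_pmf_of_set finite_files_set finite_demand_set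
          files_set_nonempty demand_set_nonempty)
    have full: "ent (real q) ?J (\<lambda>w. (?X w, ?S w, W w)) = real N * real B + real K * log (real q) (real N)"
    proof -
      have "ent (real q) ?J (\<lambda>w. (?X w, ?S w, W w)) = ent (real q) ?J snd"
      proof (rule ent_cong[OF b finJ])
        fix w w' assume "w \<in> set_pmf ?J" "w' \<in> set_pmf ?J"
        then obtain ws ds ws' ds' where w: "w = (0, ws, ds)" "w' = (0, ws', ds')"
          "length ds = K" "length ds' = K" by (auto simp: setJ demand_set_def)
        have "ds = ds' \<longleftrightarrow> (\<forall>i\<in>({..<K} - S) \<union> S. ds ! i = ds' ! i)"
          using S w by (auto simp: list_eq_iff_nth_eq)
        then show "(?X w, ?S w, W w) = (?X w', ?S w', W w') \<longleftrightarrow> snd w = snd w'"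
          unfolding w W_def d_def prod.case prod.inject restrict_eq_iff snd_conv ball_Un by blast
      qed
      also have "\<dots> = ent (real q) (map_pmf snd ?J) (\<lambda>x. x)" by (simp add: ent_map_pmf)
      also have "\<dots> = log (real q) (card (files_set N B q \<times> demand_set N K))"
        unfolding mJ using q N by (intro ent_uniform)
          (auto simp: finite_files_set finite_demand_set files_set_nonempty demand_set_nonempty)
      also have "\<dots> = real N * real B + real K * log (real q) (real N)"
        using q N log_card_files[OF q, of N B]
        by (simp add: card_cartesian_product card_demand_set log_mult log_nat_power card_files_set)
      finally show ?thesis .
    qed
    have W: "ent (real q) ?J W \<le> real N * real B"
    proof -
      have "ent (real q) ?J W \<le> log (real q) (card (files_set N B q))"
        by (rule ent_le_log_card[OF b finite_files_set]) (auto simp: W_def setJ)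
      then show ?thesis by (simp add: log_card_files[OF q])
    qed
    have "card ({..<K} - S) + card S = K"
      using S card_mono[OF _ S] by (simp add: card_Diff_subset finite_subset[OF S])
    then have "real (card ({..<K} - S)) * log (real q) (real N) + real (card S) * log (real q) (real N)
        = real K * log (real q) (real N)"
      by (metis distrib_right of_nat_add)
    then have "ent (real q) ?J (\<lambda>w. (?X w, W w)) + ent (real q) ?J (\<lambda>w. (?S w, W w))
       - ent (real q) ?J (\<lambda>w. (?X w, ?S w, W w)) - ent (real q) ?J W = 0"
      using sm full W dW[of "{..<K} - S"] dW[OF S] by auto
    then have "cond_mutual_info (measure_pmf ?J) (real q) ?X ?Y W = 0"
      using cond_mutual_info_eq_ent[OF b finJ finJ finJ, of ?X ?Y W] YW XYW by simp
    then show ?thesis unfolding joint_space_eq X[symmetric] by (simp add: W_def)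
  qed
  have "\<lceil>real N * real B\<rceil> = int (N * B)" by (metis ceiling_of_nat of_nat_mult)
  then have NB: "nat \<lceil>real N * real B\<rceil> = N * B" by (simp only: nat_int)
  show ?thesis
    unfolding achievable_def
  proof (intro exI[of _ p] exI[of _ cache] exI[of _ enc] conjI ballI allI impI)
    fix P ws k
    show "length (cache k P ws) = nat \<lfloor>M * real B\<rfloor>" by (simp add: cache_def m_def)
    show "set (cache k P ws) \<subseteq> {..<q}" using q by (auto simp: cache_def)
  next
    fix P ws ds assume "ws \<in> files_set N B q"
    then show "length (enc P ds ws) = nat \<lceil>real N * real B\<rceil>" "set (enc P ds ws) \<subseteq> {..<q}"
      using len NB by (auto simp: enc_def files_set_def)
  qed (use corr priv in auto)
qed

lemma R_opt_ge:
  assumes q: "2 \<le> q" and N: "0 < N"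
    and bound: "\<And>B R. achievable N K q M R B \<Longrightarrow> 0 \<le> R \<Longrightarrow> real B * l \<le> R * real B + 1"
  shows "ereal l \<le> R_opt N K q M"
proof -
  have "(\<lambda>B. l - 1 / real B) \<longlonglongrightarrow> l" by real_asymp
  then have "(\<lambda>B. ereal (l - 1 / real B)) \<longlonglongrightarrow> ereal l" by simp
  then have "ereal l = liminf (\<lambda>B. ereal (l - 1 / real B))"
    by (rule lim_imp_Liminf[OF trivial_limit_sequentially, symmetric])
  also have "\<dots> \<le> R_opt N K q M"
    unfolding R_opt_def
  proof (rule Liminf_mono, rule eventually_sequentiallyI[of 1])
    fix B :: nat assume B: "1 \<le> B"
    have "l - 1 / real B \<le> Inf {R. 0 \<le> R \<and> achievable N K q M R B}"
    proof (rule cInf_greatest)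
      show "{R. 0 \<le> R \<and> achievable N K q M R B} \<noteq> {}"
        using achievable_broadcast_all[OF q N] by (auto intro: exI[of _ "real N"])
      fix R assume "R \<in> {R. 0 \<le> R \<and> achievable N K q M R B}"
      then show "l - 1 / real B \<le> R" using bound[of R B] B by (simp add: field_simps)
    qed
    then show "ereal (l - 1 / real B) \<le> ereal (Inf {R. 0 \<le> R \<and> achievable N K q M R B})" by simp
  qed
  finally show ?thesis .
qed

lemma R_opt_ge_cut_set:
  assumes "2 \<le> q" "0 < N" "0 \<le> M" "s \<le> N" "s \<le> K"
  shows "ereal (real s - M * (\<Sum>k<s. real (k + 1) / (real N - real k))) \<le> R_opt N K q M"
  using assms achievable_cut_set by (intro R_opt_ge) auto

lemma R_opt_ge_private:
  assumes "2 \<le> q" "0 < N" "2 \<le> K" "0 \<le> M"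
  shows "ereal (real N * (1 - M)) \<le> R_opt N K q M"
  using assms achievable_private by (intro R_opt_ge) auto

section \<open>The convex envelope\<close>

text \<open>The epigraph of the envelope. In contrast to \<open>R_ach\<close>, an infimum of reals,
  it is closed under raising \<open>u\<close> and under chords without any argument about
  boundedness, which is left to \<open>R_ach_le\<close>.\<close>

definition epi :: "nat \<Rightarrow> nat \<Rightarrow> real \<Rightarrow> real \<Rightarrow> bool" where
  "epi N K M u \<longleftrightarrow>
    (\<exists>y\<le>u. (M, y) \<in> convex hull (insert (0, real N) ((\<lambda>t. (Mt N K t, Rt N K t)) ` {0..K})))"

lemma Rt_nonneg: "0 \<le> Rt N K t"
proof -
  have "(K - min (N - 1) K) choose (t + 1) \<le> K choose (t + 1)" by (rule binomial_right_mono) simp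
  then show ?thesis by (simp add: Rt_def)
qed

text \<open>Dropping the subtracted binomial leaves (K - t) / (t + 1), which is independent of N and
  easy to interpolate.\<close>

lemma Rt_le:
  assumes "t \<le> K"
  shows "Rt N K t \<le> (real K + 1) / (real t + 1) - 1"
proof -
  have "Suc t * (K choose Suc t) = (K - t) * (K choose t)"
    by (metis binomial_absorb_comp binomial_absorption)
  then have eq: "real (t + 1) * real (K choose (t + 1)) = (real K - real t) * real (K choose t)"
    using assms by (metis Suc_eq_plus1 of_nat_diff of_nat_mult)
  have pos: "0 < real (K choose t)" using assms by simp
  have "Rt N K t \<le> real (K choose (t + 1)) / real (K choose t)"
    unfolding Rt_def by (intro divide_right_mono) auto
  also have "\<dots> = (real K - real t) / (real t + 1)"
    using eq pos by (simp add: field_simps)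
  also have "\<dots> = (real K + 1) / (real t + 1) - 1" by (simp add: field_simps)
  finally show ?thesis .
qed

lemma R_ach_le: 
  assumes "epi N K M u"
  shows "R_ach N K M \<le> u"
proof -
  let ?A = "insert (0, real N) ((\<lambda>t. (Mt N K t, Rt N K t)) ` {0..K})"
  obtain y where y: "y \<le> u" "(M, y) \<in> convex hull ?A" using assms by (auto simp: epi_def)
  have "convex (UNIV \<times> {0::real..} :: (real \<times> real) set)" by (intro convex_Times) auto
  then have "convex hull ?A \<subseteq> UNIV \<times> {0..}"
    by (intro hull_minimal) (auto simp: Rt_nonneg)
  then have "bdd_below {y. (M, y) \<in> convex hull ?A}" by (intro bdd_belowI[of _ 0]) auto
  then have "R_ach N K M \<le> y"
    unfolding R_ach_def lower_convex_envelope_def using y(2) by (intro cInf_lower) auto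
  with y(1) show ?thesis by simp
qed

lemma epi_mono: "epi N K M u \<Longrightarrow> u \<le> u' \<Longrightarrow> epi N K M u'"
  unfolding epi_def using order_trans by blast

lemma epi_line:
  assumes e: "epi N K M1 (\<alpha> - \<beta> * M1)" "epi N K M2 (\<alpha> - \<beta> * M2)" and M: "M1 \<le> M" "M \<le> M2"
  shows "epi N K M (\<alpha> - \<beta> * M)"
proof (cases "M1 = M2")
  case True
  then show ?thesis using e M by auto
next
  case False
  then have lt: "M1 < M2" using M by simp
  let ?C = "convex hull (insert (0, real N) ((\<lambda>t. (Mt N K t, Rt N K t)) ` {0..K}))"
  define v where "v = (M - M1) / (M2 - M1)"
  have v: "0 \<le> v" "v \<le> 1" using M lt by (auto simp: v_def field_simps)
  have M_eq: "(1 - v) * M1 + v * M2 = M"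
  proof -
    have "v * (M2 - M1) = M - M1" using lt by (simp add: v_def)
    then show ?thesis by (simp add: algebra_simps)
  qed
  obtain y1 y2 where y: "y1 \<le> \<alpha> - \<beta> * M1" "(M1, y1) \<in> ?C" "y2 \<le> \<alpha> - \<beta> * M2" "(M2, y2) \<in> ?C"
    using e by (auto simp: epi_def)
  have "(1 - v) *\<^sub>R (M1, y1) + v *\<^sub>R (M2, y2) \<in> ?C"
    using y v by (intro convexD[OF convex_convex_hull]) auto
  then have "(M, (1 - v) * y1 + v * y2) \<in> ?C" by (simp add: M_eq)
  moreover have "(1 - v) * y1 + v * y2 \<le> (1 - v) * (\<alpha> - \<beta> * M1) + v * (\<alpha> - \<beta> * M2)"
    using y v by (intro add_mono mult_left_mono) auto
  moreover have "\<dots> = \<alpha> - \<beta> * ((1 - v) * M1 + v * M2)" by (simp add: algebra_simps)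
  ultimately show ?thesis unfolding epi_def M_eq by auto
qed

lemma epi_Mt: "t \<le> K \<Longrightarrow> epi N K (Mt N K t) (Rt N K t)"
  unfolding epi_def by (auto intro!: hull_inc)

lemma epi_0: "epi N K 0 (real N)"
  unfolding epi_def by (auto intro!: hull_inc)

lemma epi_1: "epi N K 1 (real (min (N - 1) K))"
  using epi_Mt[of 0 K N] by (simp add: Mt_def Rt_def of_nat_diff)

lemma epi_N: 
  assumes "0 < K"
  shows "epi N K (real N) 0"
  using epi_Mt[of K K N] assms by (simp add: Mt_def Rt_def binomial_eq_0)

lemma epi_const_N:
  assumes "0 < K" "0 \<le> M" "M \<le> real N"
  shows "epi N K M (real N)"
  using epi_line[of N K 0 "real N" 0 "real N" M] epi_0[of N K] epi_mono[OF epi_N[OF assms(1), of N], of "real N"] assms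
  by simp

text \<open>The quantity \<open>(M - 1) / (real N - 1) * real K\<close> is the real index
  \<open>t\<close> at which \<open>Mt\<close> would equal \<open>M\<close>. The lemma replaces the
  broken line through the points 1 / (t + 1) by a smooth function above it.\<close>

lemma epi_chord:
  assumes K: "0 < K" and N: "2 \<le> N" and M: "1 \<le> M" "M \<le> real N"
  shows "epi N K M ((real K + 1) / ((M - 1) / (real N - 1) * real K + 4 / 5) - 1)"
proof (cases "M = real N")
  case True
  have "(real K + 4 / 5) \<le> real K + 1" by simp
  then show ?thesis
    unfolding True using N by (intro epi_mono[OF epi_N[OF K]]) (simp add: field_simps)
next
  case False
  define \<tau> where "\<tau> = (M - 1) / (real N - 1) * real K"
  define t where "t = nat \<lfloor>\<tau>\<rfloor>"
  define v where "v = \<tau> - real t"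
  have d: "0 < real N - 1" using N by simp
  have \<tau>: "0 \<le> \<tau>" "\<tau> < real K" using M False K d by (auto simp: \<tau>_def field_simps)
  have v: "0 \<le> v" "v \<le> 1" using \<tau>(1) by (auto simp: v_def t_def) linarith
  have t: "t < K" using \<tau> by (simp add: t_def) linarith
  \<comment> \<open>The line through the majorants (K + 1) / (t + 1) - 1 of two consecutive
    points.\<close>
  define \<beta> where "\<beta> = (real K + 1) * real K / ((real t + 1) * (real t + 2) * (real N - 1))"
  define \<alpha> where "\<alpha> = (real K + 1) / (real t + 1) - 1 + \<beta> * Mt N K t"
  have step: "Mt N K (t + 1) = Mt N K t + (real N - 1) / real K"
    using K by (simp add: Mt_def field_simps)
  have M_eq: "M = Mt N K t + v * ((real N - 1) / real K)"
    using K d by (simp add: Mt_def v_def \<tau>_def field_simps)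
  have \<beta>_eq: "\<beta> * ((real N - 1) / real K) = (real K + 1) / ((real t + 1) * (real t + 2))"
    using K d by (simp add: \<beta>_def)
  have frac: "c / x - v * (c / (x * y)) = c * ((y - v) / (x * y))" if "0 < x" "0 < y" for c v x y :: real
    using that by (simp add: field_simps)
  have e1: "epi N K (Mt N K t) (\<alpha> - \<beta> * Mt N K t)"
    using epi_mono[OF epi_Mt Rt_le] t by (simp add: \<alpha>_def)
  have "\<alpha> - \<beta> * Mt N K (t + 1) = (real K + 1) / (real t + 1) - 1 - (real K + 1) / ((real t + 1) * (real t + 2))"
    unfolding step \<alpha>_def using \<beta>_eq by (simp add: algebra_simps)
  also have "\<dots> = (real K + 1) / (real (t + 1) + 1) - 1"
  proof -
    have "c / x - 1 - c / (x * (x + 1)) = c / (x + 1) - 1" if "0 < x" for c x :: real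
      using frac[where x = x and y = "x + 1" and v = 1 and c = c] that by simp
    from this[of "real t + 1" "real K + 1"] show ?thesis by (simp add: add_ac)
  qed
  finally have e2: "epi N K (Mt N K (t + 1)) (\<alpha> - \<beta> * Mt N K (t + 1))"
    using epi_mono[OF epi_Mt Rt_le, of "t + 1" K N] t by simp
  have range: "Mt N K t \<le> M" "M \<le> Mt N K (t + 1)"
    unfolding step M_eq using v d mult_right_mono[of v 1 "(real N - 1) / real K"] by auto
  have "\<alpha> - \<beta> * M = (real K + 1) / (real t + 1) - 1 - v * ((real K + 1) / ((real t + 1) * (real t + 2)))"
    unfolding M_eq \<alpha>_def \<beta>_eq[symmetric] by (simp add: algebra_simps)
  also have "\<dots> = (real K + 1) * ((real t + 2 - v) / ((real t + 1) * (real t + 2))) - 1"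
    using frac[where x = "real t + 1" and y = "real t + 2" and v = v and c = "real K + 1"] by simp
  also have "\<dots> \<le> (real K + 1) * (1 / (\<tau> + 4 / 5)) - 1"
  proof -
    \<comment> \<open>With a shift \<open>c\<close> instead of 4/5, the case t = 0 holds for all
      \<open>v\<close> exactly if c \<le> 2 * sqrt 2 - 2, about 0.828; 4/5 is a simple rational
      below that.\<close>
    have "(real t + 1) * (real t + 2) - (real t + 2 - v) * (real t + v + 4 / 5) =
        (v - 3 / 5)\<^sup>2 + real t / 5 + 1 / 25"
      by (simp add: field_simps power2_eq_square)
    moreover have "0 \<le> (v - 3 / 5)\<^sup>2" by simp
    ultimately have "(real t + 2 - v) * (real t + v + 4 / 5) \<le> (real t + 1) * (real t + 2)"
      by linarith
    then have "(real t + 2 - v) / ((real t + 1) * (real t + 2)) \<le> 1 / (real t + v + 4 / 5)"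
      using v by (simp add: divide_simps)
    then show ?thesis by (intro diff_right_mono mult_left_mono) (auto simp: v_def)
  qed
  finally show ?thesis
    using epi_mono[OF epi_line[OF e1 e2 range]] by (simp add: \<tau>_def)
qed

text \<open>With a = (M - 1) / (N - 1), the bound (K + 1) / (a K + 4/5) grows with K as long as a
  \<le> 4/5, which is the second condition on \<open>M\<close>. So K = N - 1 is the worst
  case.\<close>

lemma epi_few_users:
  assumes K: "0 < K" "K < N" and M: "1 \<le> M" "5 * (M - 1) \<le> 4 * (real N - 1)"
  shows "epi N K M (real N / (M - 1 / 5) - 1)"
proof (rule epi_mono[OF epi_chord])
  define d where "d = real N - 1"
  define a where "a = (M - 1) / d"
  have d: "0 < d" "real K \<le> d" "real N = d + 1" using K by (auto simp: d_def)
  have ad: "a * d = M - 1" using d by (simp add: a_def)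
  have "a * d \<le> (4 / 5) * d" unfolding ad using M(2) by (simp add: d_def)
  then have "a \<le> 4 / 5" using d(1) by (rule mult_right_le_imp_le)
  moreover have "0 \<le> a" using M(1) d by (simp add: a_def)
  ultimately have a: "0 \<le> a" "a \<le> 4 / 5" by auto
  have M_eq: "M - 1 / 5 = a * d + 4 / 5" using d by (simp add: a_def)
  have "0 \<le> (4 / 5 - a) * (d - real K)" using a d by simp
  then have "(real K + 1) * (a * d + 4 / 5) \<le> (d + 1) * (a * real K + 4 / 5)"
    by (simp add: algebra_simps add_divide_distrib diff_divide_distrib)
  moreover have "0 < a * real K + 4 / 5" "0 < a * d + 4 / 5"
    using a d by (auto intro!: add_nonneg_pos mult_nonneg_nonneg)
  moreover have "p / y \<le> r / x" if "p * x \<le> r * y" "0 < y" "0 < x" for p r x y :: real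
    using that by (simp add: divide_simps mult.commute)
  ultimately have "(real K + 1) / (a * real K + 4 / 5) \<le> (d + 1) / (a * d + 4 / 5)" by blast
  then show "(real K + 1) / ((M - 1) / (real N - 1) * real K + 4 / 5) - 1 \<le> real N / (M - 1 / 5) - 1"
    unfolding M_eq d(3) by (simp add: a_def)
qed (use K M in auto)

text \<open>The right-hand side is the chord between the points t = 0 and t = 1 for K = N - 1. At M
  = 1 it equals N - 1, where \<open>epi_few_users\<close> gives only 5N/4 - 1.\<close>

lemma epi_few_users_small:
  assumes K: "0 < K" "K < N" and M: "1 \<le> M" "M \<le> 2"
  shows "epi N K M (real N * (3 - M) / 2 - 1)"
proof -
  define d where "d = real N - 1"
  have d: "0 < d" "real K \<le> d" "real N = d + 1" using K by (auto simp: d_def)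
  define \<beta> where "\<beta> = real K * (real K + 1) / (2 * d)"
  have "\<beta> * d / real K = (real K + 1) / 2" using d K by (simp add: \<beta>_def)
  then have "real K + \<beta> - \<beta> * Mt N K 1 = (real K + 1) / 2 - 1"
    by (simp add: Mt_def d(3) algebra_simps)
  then have e2: "epi N K (Mt N K 1) (real K + \<beta> - \<beta> * Mt N K 1)"
    using K Rt_le[of 1 K N] by (intro epi_mono[OF epi_Mt]) auto
  have e1: "epi N K 1 (real K + \<beta> - \<beta> * 1)" using epi_1[of N K] K by (simp add: min_absorb2)
  have "1 \<le> d / real K" using d K by simp
  then have "M \<le> Mt N K 1" using M by (simp add: Mt_def d(3))
  then have "epi N K M (real K + \<beta> - \<beta> * M)" using epi_line[OF e1 e2] M by simp
  moreover have "real K + \<beta> - \<beta> * M \<le> real N * (3 - M) / 2 - 1"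
  proof -
    \<comment> \<open>Integrality matters: the second factor of the product below is nonnegative
      once K + 1 \<le> d, and otherwise the first factor vanishes.\<close>
    have "K + 1 = N \<or> K + 2 \<le> N" using K by linarith
    then have nat: "real K = d \<or> real K + 1 \<le> d" by (auto simp: d_def)
    have "(M - 1) * (d + real K + 1) \<le> 2 * d \<or> real K = d"
    proof (cases "real K = d")
      case False
      then have "(M - 1) * (d + real K + 1) \<le> 1 * (2 * d)"
        using M nat d by (intro mult_mono) auto
      then show ?thesis by simp
    qed simp
    then have "0 \<le> (d - real K) * (2 * d - (M - 1) * (d + real K + 1))"
      using d by auto
    also have "\<dots> = 2 * d * (real N * (3 - M) / 2 - 1 - (real K + \<beta> - \<beta> * M))"
      using d by (simp add: \<beta>_def field_simps)
    finally show ?thesis using d by (simp add: zero_le_mult_iff)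
  qed
  ultimately show ?thesis by (rule epi_mono)
qed

text \<open>The value is the limit of \<open>epi_chord\<close> for large K, approached from below
  while (M - 1) / (N - 1) \<le> 4/5.\<close>

lemma epi_many_users:
  assumes N: "2 \<le> N" "N \<le> K" and M: "1 < M" "5 * (M - 1) \<le> 4 * (real N - 1)"
  shows "epi N K M ((real N - 1) / (M - 1) - 1)"
proof (rule epi_mono[OF epi_chord])
  define d where "d = real N - 1"
  define a where "a = (M - 1) / d"
  have d: "0 < d" using N by (auto simp: d_def)
  have ad: "a * d = M - 1" using d by (simp add: a_def)
  have "a * d \<le> (4 / 5) * d" unfolding ad using M(2) by (simp add: d_def)
  then have "a \<le> 4 / 5" using d by (rule mult_right_le_imp_le)
  moreover have "0 < a" using M(1) d by (simp add: a_def)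
  ultimately have a: "0 < a" "a \<le> 4 / 5" by auto
  have "(real K + 1) / (a * real K + 4 / 5) \<le> 1 / a"
    using a N by (simp add: divide_simps add_pos_pos algebra_simps)
  then show "(real K + 1) / ((M - 1) / (real N - 1) * real K + 4 / 5) - 1 \<le> (real N - 1) / (M - 1) - 1"
    by (simp add: a_def d_def)
qed (use N M in auto)

section \<open>Comparison of the envelope with the converse bounds\<close>

text \<open>Reduces an inequality affine in N with nonnegative slope to the smallest N.\<close>

lemma affine_nonneg_mono:
  fixes a c k n :: real
  assumes "0 \<le> k * a + c" "0 \<le> a" "k \<le> n"
  shows "0 \<le> n * a + c"
  using mult_right_mono[OF assms(3,2)] assms(1) by linarith

section \<open>Closed forms of the lower bounds\<close>

definition cut_load :: "nat \<Rightarrow> nat \<Rightarrow> real" where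
  "cut_load N s = (\<Sum>k<s. real (k + 1) / (real N - real k))"

lemma cut_load_Suc: "cut_load N (Suc s) = cut_load N s + real (s + 1) / (real N - real s)"
  by (simp add: cut_load_def)

lemma cut_load_le:
  assumes "s \<le> N"
  shows "cut_load N s \<le> real s * (real s + 1) / (2 * (real N + 1 - real s))"
proof -
  have "cut_load N s \<le> (\<Sum>k<s. real (k + 1) / (real N + 1 - real s))"
    unfolding cut_load_def using assms by (intro sum_mono divide_left_mono mult_pos_pos) auto
  also have "\<dots> = (\<Sum>k<s. real (k + 1)) / (real N + 1 - real s)"
    by (simp add: sum_divide_distrib)
  also have "(\<Sum>k<s. real (k + 1)) = real s * (real s + 1) / 2"
    by (induction s) (simp_all add: field_simps)
  finally show ?thesis by simp
qed

lemma cut_load_1: "cut_load N (Suc 0) = 1 / real N"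
  by (simp add: cut_load_def)

lemma cut_load_2: "cut_load N 2 = 1 / real N + 2 / (real N - 1)"
  by (simp add: cut_load_def numeral_2_eq_2)

lemma cut_load_3: "cut_load N 3 = 1 / real N + 2 / (real N - 1) + 3 / (real N - 2)"
  by (simp add: cut_load_def numeral_3_eq_3)

locale caching_params =
  fixes N K q :: nat
  assumes N: "2 \<le> N" and K: "2 \<le> K" and q: "2 \<le> q"
begin

lemma R_opt_ge_cut:
  assumes "0 \<le> M" "s \<le> N" "s \<le> K"
  shows "ereal (real s - M * cut_load N s) \<le> R_opt N K q M"
  using R_opt_ge_cut_set[OF q _ assms] N by (simp add: cut_load_def)

lemma R_opt_ge_priv: "0 \<le> M \<Longrightarrow> ereal (real N * (1 - M)) \<le> R_opt N K q M"
  using R_opt_ge_private[OF q _ K] N by simp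

lemma R_opt_nonneg: "0 \<le> M \<Longrightarrow> 0 \<le> R_opt N K q M"
  using R_opt_ge_cut[of M 0] by (simp add: cut_load_def zero_ereal_def)

lemma R_ach_le_mult:
  assumes "epi N K M (c * l)" "ereal l \<le> R_opt N K q M" "0 \<le> c"
  shows "ereal (R_ach N K M) \<le> ereal c * R_opt N K q M"
proof -
  have "ereal (R_ach N K M) \<le> ereal c * ereal l" using R_ach_le[OF assms(1)] by simp
  also have "\<dots> \<le> ereal c * R_opt N K q M" using assms by (intro ereal_mult_left_mono) auto
  finally show ?thesis .
qed

lemma R_ach_le_cut:
  assumes s: "s \<le> N" "s \<le> K" and c: "0 \<le> c" and M: "0 \<le> M" "M1 \<le> M" "M \<le> M2"
    and e: "epi N K M1 (c * (real s - M1 * cut_load N s))" "epi N K M2 (c * (real s - M2 * cut_load N s))"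
  shows "ereal (R_ach N K M) \<le> ereal c * R_opt N K q M"
proof (rule R_ach_le_mult[OF _ R_opt_ge_cut[OF M(1) s] c])
  have "epi N K M (c * real s - (c * cut_load N s) * M)"
    using e by (intro epi_line[OF _ _ M(2,3)]) (simp_all add: algebra_simps)
  then show "epi N K M (c * (real s - M * cut_load N s))" by (simp add: algebra_simps)
qed

text \<open>Interpolating the cut-set bounds for \<open>s\<close> and \<open>s + 1\<close> removes the rounding of the optimal \<open>s\<close>.\<close>

lemma R_opt_ge_interpolated:
  assumes M: "0 \<le> M" and x: "0 \<le> x" "x < real N" "x < real K"
  shows "ereal (x - M * ((x + 1 / 2)\<^sup>2 / (2 * (real N - x)))) \<le> R_opt N K q M"
proof -
  define s where "s = nat \<lfloor>x\<rfloor>"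
  define v where "v = x - real s"
  have v: "0 \<le> v" "v \<le> 1" "x = real s + v" using x(1) by (auto simp: v_def s_def) linarith
  have s: "s < N" "s < K" using x by (auto simp: s_def) linarith+
  have gap: "0 < real N - x" "real N - x \<le> real N - real s" using x v by auto
  define l where "l i = real i - M * cut_load N i" for i
  have "cut_load N s + v * (real (s + 1) / (real N - real s)) \<le>
      real s * (real s + 1) / (2 * (real N - real s)) + v * (real (s + 1) / (real N - real s))"
  proof -
    have "real s * (real s + 1) / (2 * (real N + 1 - real s)) \<le> real s * (real s + 1) / (2 * (real N - real s))"
      using s by (intro divide_left_mono mult_pos_pos) auto
    then show ?thesis using cut_load_le[of s N] s by simp
  qed
  also have "\<dots> = (real s * (real s + 1) + 2 * v * (real s + 1)) / (2 * (real N - real s))"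
    using s by (simp add: add_divide_distrib) (simp add: field_simps)
  also have "\<dots> \<le> (x + 1 / 2)\<^sup>2 / (2 * (real N - real s))"
  proof (rule divide_right_mono)
    \<comment> \<open>Completing the square; this is the origin of the shift 1/2 in the interpolated
      bound.\<close>
    have "(x + 1 / 2)\<^sup>2 - (real s * (real s + 1) + 2 * v * (real s + 1)) = (v - 1 / 2)\<^sup>2"
      unfolding v(3) by (simp add: power2_eq_square field_simps)
    moreover have "0 \<le> (v - 1 / 2)\<^sup>2" by simp
    ultimately show "real s * (real s + 1) + 2 * v * (real s + 1) \<le> (x + 1 / 2)\<^sup>2" by linarith
  qed (use s in simp)
  also have "\<dots> \<le> (x + 1 / 2)\<^sup>2 / (2 * (real N - x))"
    using gap by (intro divide_left_mono mult_pos_pos) auto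
  finally have "M * (cut_load N s + v * (real (s + 1) / (real N - real s))) \<le>
      M * ((x + 1 / 2)\<^sup>2 / (2 * (real N - x)))"
    using M by (rule mult_left_mono)
  then have "x - M * ((x + 1 / 2)\<^sup>2 / (2 * (real N - x))) \<le> (1 - v) * l s + v * l (Suc s)"
    unfolding l_def cut_load_Suc v(3) by (simp add: algebra_simps)
  also have "\<dots> \<le> max (l s) (l (Suc s))"
  proof -
    have "(1 - v) * l s + v * l (Suc s) \<le> (1 - v) * max (l s) (l (Suc s)) + v * max (l s) (l (Suc s))"
      using v by (intro add_mono mult_left_mono) auto
    then show ?thesis by (simp add: algebra_simps)
  qed
  finally have le: "x - M * ((x + 1 / 2)\<^sup>2 / (2 * (real N - x))) \<le> max (l s) (l (Suc s))" .
  have "ereal (max (l s) (l (Suc s))) \<le> R_opt N K q M"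
    using R_opt_ge_cut[OF M, of s] R_opt_ge_cut[OF M, of "Suc s"] s
    by (cases "l s \<le> l (Suc s)") (simp_all add: l_def max_absorb1 max_absorb2)
  then show ?thesis by (rule order_trans[rotated]) (use le in \<open>simp only: ereal_less_eq\<close>)
qed

text \<open>The choice \<open>x + 1/2 = (2N + 1) / (2M + 3)\<close> is close to the maximiser of the interpolated bound.\<close>

lemma R_opt_ge_rational:
  assumes M: "0 \<le> M" "M \<le> real N" and x: "(2 * real N + 1) / (2 * M + 3) - 1 / 2 < real K"
  shows "ereal ((2 * real N + 1) * (M + 1) / ((2 * M + 3) * (2 * M + 1)) - 1 / 2) \<le> R_opt N K q M"
proof -
  \<comment> \<open>With y = x + 1/2 the bound reads y - 1/2 - M y^2 / (n - 2 y). Its exact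
    maximiser is y = n (1 - sqrt (M / (M + 2))) / 2; the factor 1 / (2 M + 3) agrees with that of n
    up to second order in 1/M and avoids the root.\<close>
  define n where "n = 2 * real N + 1"
  define a where "a = 2 * M + 3"
  have a: "0 < a" "0 < a - 2" "0 < n" using M by (auto simp: a_def n_def)
  let ?x = "n / a - 1 / 2"
  have x0: "0 \<le> ?x"
    using a M N by (simp add: field_simps) (simp add: a_def n_def)
  have "n * 1 \<le> n * (a - 2)" using a M by (intro mult_left_mono) (auto simp: a_def)
  have Nx: "real N - ?x = n * (a - 2) / (2 * a)" using a by (simp add: n_def field_simps)
  moreover have "0 < n * (a - 2) / (2 * a)" using a by simp
  ultimately have xN: "?x < real N" by linarith
  have "M * ((?x + 1 / 2)\<^sup>2 / (2 * (real N - ?x))) = M * n / (a * (a - 2))"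
    unfolding Nx using a by (simp add: power2_eq_square field_simps)
  also have "\<dots> = n * (a - 3) / (2 * (a * (a - 2)))" using a by (simp add: a_def)
  finally have "?x - M * ((?x + 1 / 2)\<^sup>2 / (2 * (real N - ?x))) =
      (n / a - n * (a - 3) / (2 * (a * (a - 2)))) - 1 / 2"
    by simp
  also have "n / a - n * (a - 3) / (2 * (a * (a - 2))) = n * (a - 1) / (2 * (a * (a - 2)))"
    using a by (simp add: field_simps)
  also have "\<dots> = n * (M + 1) / ((2 * M + 3) * (2 * M + 1))"
  proof -
    have "a - 1 = 2 * (M + 1)" "a - 2 = 2 * M + 1" by (simp_all add: a_def)
    then have "n * (a - 1) / (2 * (a * (a - 2))) = (2 * (n * (M + 1))) / (2 * (a * (2 * M + 1)))"
      by (simp only: mult.left_commute)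
    also have "\<dots> = n * (M + 1) / (a * (2 * M + 1))" by (rule mult_divide_mult_cancel_left) simp
    finally show ?thesis by (simp add: a_def)
  qed
  finally have eq: "?x - M * ((?x + 1 / 2)\<^sup>2 / (2 * (real N - ?x))) =
      n * (M + 1) / ((2 * M + 3) * (2 * M + 1)) - 1 / 2" .
  have "?x < real K" using x by (simp add: n_def a_def)
  from R_opt_ge_interpolated[OF M(1) x0 xN this] show ?thesis
    unfolding eq by (simp only: n_def)
qed

section \<open>Comparison by cache size and number of files\<close>

lemma gap_small_cache_many_files:
  assumes M: "0 \<le> M" "M \<le> 1" and NK: "2 * K \<le> N"
  shows "ereal (R_ach N K M) \<le> ereal 2 * R_opt N K q M"
proof -
  have "epi N K 1 (real K)" using epi_1[of N K] NK K by (simp add: min_absorb2)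
  then have e: "epi N K M (real N - (real N - real K) * M)"
    using epi_line[of N K 0 "real N" "real N - real K" 1 M] M epi_0[of N K] by simp
  show ?thesis
  \<comment> \<open>At M = N / (N + K) the privacy bound meets K - M K^2 / N, a weakening of the
    cut-set bound for s = K. The privacy bound serves to the left, the cut-set bound to the
    right.\<close>
  proof (cases "M * real K \<le> real N * (1 - M)")
    case True
    then show ?thesis
      by (intro R_ach_le_mult[OF epi_mono[OF e] R_opt_ge_priv[OF M(1)]]) (auto simp: algebra_simps)
  next
    case False
    have "real N * cut_load N K \<le> (real K)\<^sup>2"
    proof -
      have "real N * cut_load N K \<le> real N * (real K * (real K + 1) / (2 * (real N + 1 - real K)))"
        using cut_load_le[of K N] NK by (intro mult_left_mono) auto
      also have "\<dots> \<le> (real K)\<^sup>2"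
      proof -
        have "0 \<le> (real K - 1) * (real N - 2 * real K)"
          using K NK by (intro mult_nonneg_nonneg) auto
        then have "0 \<le> real K * ((real K - 1) * (real N - 2 * real K))" by simp
        moreover have "0 < 2 * (real N + 1 - real K)" using NK by simp
        ultimately show ?thesis
          by (simp add: pos_divide_le_eq power2_eq_square algebra_simps)
      qed
      finally show ?thesis .
    qed
    then have "M * (real N * cut_load N K) \<le> M * (real K)\<^sup>2" using M by (intro mult_left_mono) auto
    \<comment> \<open>Once N times \<open>cut_load N K\<close> is replaced by K^2, this product is
      exactly the slack of the claim.\<close>
    moreover have "0 \<le> (real N - 2 * real K) * (M * (real N + real K) - real N)"
      using False NK by (intro mult_nonneg_nonneg) (auto simp: algebra_simps)
    ultimately have "real N * (real N - (real N - real K) * M) \<le> real N * (2 * (real K - M * cut_load N K))"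
      by (simp add: algebra_simps power2_eq_square)
    then have "real N - (real N - real K) * M \<le> 2 * (real K - M * cut_load N K)"
      using N by simp
    then show ?thesis
      using NK by (intro R_ach_le_mult[OF epi_mono[OF e] R_opt_ge_cut[OF M(1), of K]]) auto
  qed
qed

text \<open>Compares the trivial load N with the privacy bound; it serves the factor 2 up to M = 1/2
  and the factor 4 up to M = 3/4.\<close>

lemma gap_tiny_cache:
  assumes M: "0 \<le> M" and c: "2 \<le> c" "real N \<le> c * (real N * (1 - M))"
  shows "ereal (R_ach N K M) \<le> ereal c * R_opt N K q M"
proof (rule R_ach_le_mult[OF epi_mono[OF epi_const_N] R_opt_ge_priv[OF M]])
  show "M \<le> real N"
  proof (rule ccontr)
    assume "\<not> M \<le> real N"
    then have "real N * (1 - M) \<le> 0" using N by (intro mult_nonneg_nonpos) auto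
    then have "c * (real N * (1 - M)) \<le> 0" using c(1) by (intro mult_nonneg_nonpos[of c]) auto
    moreover have "0 < real N" using N by simp
    ultimately show False using c(2) by linarith
  qed
qed (use K M c in auto)

lemma gap_small_cache_few_files:
  assumes M: "1 / 2 \<le> M" "M \<le> 1" and NK: "N < 2 * K"
  shows "ereal (R_ach N K M) \<le> ereal 4 * R_opt N K q M"
proof (cases "M \<le> 3 / 4")
  case True
  have "real N * 1 \<le> real N * (4 * (1 - M))" using True by (intro mult_left_mono) auto
  then have "real N \<le> 4 * (real N * (1 - M))" by (simp add: algebra_simps)
  then show ?thesis using M by (intro gap_tiny_cache) auto
next
  case False
  have "epi N K 1 (real N - 1)"
    using N by (intro epi_mono[OF epi_1]) (auto simp: min_def)
  then have e: "epi N K M (real N - 1 * M)"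
    using epi_line[of N K 0 "real N" 1 1 M] M epi_0[of N K] by simp
  consider "N = 2" | "N = 3 \<or> N = 4 \<or> N = 5 \<or> N = 6" | "7 \<le> N" using N by linarith
  then show ?thesis
  proof cases
    case 1
    then show ?thesis
      using M K by (intro R_ach_le_mult[OF epi_mono[OF e] R_opt_ge_cut[of M 1]]) (auto simp: cut_load_1)
  next
    case 2
    then have "real N - 1 * M \<le> 4 * (real 2 - M * cut_load N 2)"
      unfolding cut_load_2 using M False by (elim disjE) (simp_all add: field_simps)
    then show ?thesis
      using M K N by (intro R_ach_le_mult[OF epi_mono[OF e] R_opt_ge_cut[of M 2]]) auto
  next
    case 3
    \<comment> \<open>This is \<open>x + 1 / 2 = (2 * real N + 1) / (2 * M + 3)\<close> evaluated at
      M = 1, the hardest cache size here. At that point the factor 4 amounts to N \<ge> 7; N < 2K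
      keeps \<open>x\<close> below K.\<close>
    define x where "x = 2 / 5 * (real N + 1 / 2) - 1 / 2"
    have "7 \<le> real N" "real N < 2 * real K" using 3 NK by auto
    then have "0 \<le> x \<and> x < real N \<and> x < real K" by (simp add: x_def algebra_simps)
    then have x: "0 \<le> x" "x < real N" "x < real K" by auto
    have load: "(x + 1 / 2)\<^sup>2 / (2 * (real N - x)) = 2 / 15 * (real N + 1 / 2)"
    proof -
      have "real N - x = 3 / 5 * (real N + 1 / 2)" by (simp add: x_def field_simps)
      then show ?thesis by (simp add: x_def power2_eq_square field_simps)
    qed
    have "M * (real N - 7) \<le> 1 * (real N - 7)" using M 3 by (intro mult_right_mono) auto
    then have "real N - 1 * M \<le> 4 * (x - M * ((x + 1 / 2)\<^sup>2 / (2 * (real N - x))))"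
      unfolding load using M 3 by (simp add: x_def field_simps)
    then show ?thesis
      using M by (intro R_ach_le_mult[OF epi_mono[OF e] R_opt_ge_interpolated[OF _ x]]) auto
  qed
qed

lemma gap_few_users:
  assumes M: "1 \<le> M" "M \<le> real N" and KN: "K < N"
  shows "ereal (R_ach N K M) \<le> ereal 4 * R_opt N K q M"
proof -
  have N3: "3 \<le> N" using KN K by simp
  have e1: "epi N K 1 (real K)" using epi_1[of N K] KN by (simp add: min_absorb2)
  \<comment> \<open>8/3 is 4 (1 - 1/3), four times the cut-set bound for s = 1 at M = N/3. From
    there to M = N that bound is enough.\<close>
  have e3: "epi N K (real N / 3) (8 / 3)"
  proof (cases "N \<le> 5")
    case True
    then have "N = 3 \<or> N = 4 \<or> N = 5" using N3 by linarith
    then have "real N * (3 - real N / 3) / 2 - 1 \<le> 8 / 3" by auto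
    then show ?thesis using N3 K KN True by (intro epi_mono[OF epi_few_users_small]) auto
  next
    case False
    then have "real N / (real N / 3 - 1 / 5) - 1 \<le> 8 / 3" by (simp add: divide_simps)
    then show ?thesis using K KN False by (intro epi_mono[OF epi_few_users]) auto
  qed
  consider "real N / 3 \<le> M" | "M \<le> real N / 3" "N \<le> 7" | "M \<le> real N / 3" "N = 8"
    | "M \<le> real N / 3" "9 \<le> N" "real K \<le> (2 * real N + 1) / (2 * M + 3) - 1 / 2"
    | "M \<le> real N / 3" "9 \<le> N" "(2 * real N + 1) / (2 * M + 3) - 1 / 2 < real K"
    by linarith
  then show ?thesis
  proof cases
    case 1
    show ?thesis
      by (rule R_ach_le_cut[of 1 4 M "real N / 3" "real N"])
        (use 1 M N K e3 epi_N[of K N] in \<open>auto simp: cut_load_1\<close>)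
  next
    case 2
    then have cases: "N = 3 \<or> N = 4 \<or> N = 5 \<or> N = 6 \<or> N = 7" using N3 by linarith
    have "real N - 1 \<le> 4 * (real 2 - 1 * cut_load N 2)"
      unfolding cut_load_2 using cases by (elim disjE) simp_all
    moreover have "8 / 3 \<le> 4 * (real 2 - real N / 3 * cut_load N 2)"
      unfolding cut_load_2 using cases by (elim disjE) simp_all
    ultimately show ?thesis
      using 2 M K N KN by (intro R_ach_le_cut[of 2 4 M 1 "real N / 3"] epi_mono[OF e1] epi_mono[OF e3]) auto
  next
    case 3
    \<comment> \<open>For N = 8 and s = 3, four times the cut-set bound at M = 8/3 is 16/7 < 8/3, so
      \<open>e3\<close> is too weak and a sharper end value is taken. K = 2 is apart because s = 3
      needs three users.\<close>
    have "epi N K (real N / 3) (8 / (8 / 3 - 1 / 5) - 1)"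
      using epi_few_users[of K N "real N / 3"] K KN 3 by simp
    note e3' = this
    show ?thesis
    proof (cases "K = 2")
      case True
      then show ?thesis
        using 3 M by (intro R_ach_le_cut[of 2 4 M 1 "real N / 3"] epi_mono[OF e1] epi_mono[OF e3'])
          (auto simp: cut_load_2)
    next
      case False
      then show ?thesis
        using 3 M K KN by (intro R_ach_le_cut[of 3 4 M 1 "real N / 3"] epi_mono[OF e1] epi_mono[OF e3'])
          (auto simp: cut_load_3)
    qed
  next
    case 4
    \<comment> \<open>The near-optimal \<open>x\<close> is at least K, so all users enter the cut.
      The envelope is at most K, and it remains to show that the cut-set bound loses at most 3/4 of
      K.\<close>
    have KM: "real K * (2 * M + 3) \<le> 2 * real N - M - 1 / 2"
    proof -
      have "(real K + 1 / 2) * (2 * M + 3) \<le> 2 * real N + 1"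
        by (rule pos_le_divide_eq[THEN iffD1]) (use 4(3) M in auto)
      then show ?thesis by (simp add: algebra_simps add_divide_distrib)
    qed
    have "2 * M * (real K + 1) \<le> 3 * (real N + 1 - real K)"
    proof -
      have "2 * M \<le> real K * M" using K M by (intro mult_right_mono) auto
      then show ?thesis using KM M K by (simp add: algebra_simps)
    qed
    then have "M * (real K * (real K + 1) / (2 * (real N + 1 - real K))) \<le> 3 / 4 * real K"
    proof -
      have pos: "0 < real N + 1 - real K" using KN by simp
      have "real K * (2 * M * (real K + 1)) \<le> real K * (3 * (real N + 1 - real K))"
        by (intro mult_left_mono) (use \<open>2 * M * (real K + 1) \<le> 3 * (real N + 1 - real K)\<close> in auto)
      then show ?thesis using pos by (simp add: divide_simps) (simp add: algebra_simps)
    qed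
    moreover have "M * cut_load N K \<le> M * (real K * (real K + 1) / (2 * (real N + 1 - real K)))"
      using cut_load_le[of K N] KN M by (intro mult_left_mono) auto
    ultimately have "M * cut_load N K \<le> 3 / 4 * real K" by (rule order_trans[rotated])
    then have "real K \<le> 4 * (real K - M * cut_load N K)" by simp
    moreover have "epi N K M (real K - 0 * M)"
      by (rule epi_line[of N K 1 _ _ "real N"]) (use e1 epi_mono[OF epi_N[of K N], of "real K"] K M in auto)
    ultimately show ?thesis
      using KN M by (intro R_ach_le_mult[OF epi_mono R_opt_ge_cut[of M K]]) auto
  next
    case 5
    define D where "D = (2 * M + 3) * (2 * M + 1)"
    have "0 < D" unfolding D_def using M by (intro mult_pos_pos) auto
    moreover have "D = 4 * M\<^sup>2 + 8 * M + 3" by (simp add: D_def power2_eq_square algebra_simps)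
    ultimately have D: "0 < D" "D = 4 * M\<^sup>2 + 8 * M + 3" by auto
    show ?thesis
    proof (rule R_ach_le_mult[OF _ R_opt_ge_rational[OF _ M(2) 5(3)]])
      show "epi N K M (4 * ((2 * real N + 1) * (M + 1) / ((2 * M + 3) * (2 * M + 1)) - 1 / 2))"
      proof (cases "M \<le> 2")
        case True
        \<comment> \<open>\<open>r\<close> approximates the minimiser on \<open>M \<ge> 0\<close> of the cubic for \<open>N = 9\<close>, whose minimum is barely positive.\<close>
        define r where "r = (609 / 500 :: real)"
        have "0 \<le> (M - r)\<^sup>2 * (M + (2 * r - 11 / 9))" using M by (simp add: r_def)
        then have "0 \<le> 9 * (2 * M^3 - 2 * M\<^sup>2 - 5 / 2 * M + 7 / 2) + (1 - 4 * M - 4 * M\<^sup>2)"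
          using M by (simp add: r_def power2_eq_square power3_eq_cube field_simps)
        moreover have "0 \<le> (M - 1)\<^sup>2 * (2 * M + 2)" using M by simp
        then have "0 \<le> 2 * M^3 - 2 * M\<^sup>2 - 5 / 2 * M + 7 / 2"
          using True by (simp add: power2_eq_square power3_eq_cube field_simps)
        ultimately have "0 \<le> real N * (2 * M^3 - 2 * M\<^sup>2 - 5 / 2 * M + 7 / 2) + (1 - 4 * M - 4 * M\<^sup>2)"
          by (rule affine_nonneg_mono) (use 5(2) in simp)
        then have "(real N * (3 - M) / 2 + 1) * D \<le> 4 * ((2 * real N + 1) * (M + 1))"
          unfolding D(2) by (simp add: power2_eq_square power3_eq_cube field_simps)
        then have "real N * (3 - M) / 2 + 1 \<le> 4 * ((2 * real N + 1) * (M + 1)) / D"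
          using D(1) by (simp add: le_divide_eq)
        then show ?thesis
          using True M K KN by (intro epi_mono[OF epi_few_users_small]) (auto simp: D_def)
      next
        case False
        \<comment> \<open>The claim is affine in N and M \<le> N/3, so N = 3M is the worst case.
          This product is, up to a positive constant, the slack there.\<close>
        have "0 \<le> (M - 2) * (8 * M\<^sup>2 + 8 * M + 4)" using False by simp
        then have "(4 * M\<^sup>2 + 4 * M - 1) * (M - 1 / 5) \<le> (3 * M) * (4 * M\<^sup>2 - 8 / 5 * M - 23 / 5)"
          using False by (simp add: power2_eq_square field_simps)
        also have "\<dots> \<le> real N * (4 * M\<^sup>2 - 8 / 5 * M - 23 / 5)"
        proof (rule mult_right_mono)
          have "0 \<le> (M - 2) * (4 * M + 6)" using False by simp
          then show "0 \<le> 4 * M\<^sup>2 - 8 / 5 * M - 23 / 5"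
            using False by (simp add: power2_eq_square algebra_simps)
        qed (use 5(1) in simp)
        finally have "(real N + (M - 1 / 5)) * D \<le> 4 * ((2 * real N + 1) * (M + 1)) * (M - 1 / 5)"
          unfolding D(2) by (simp add: power2_eq_square field_simps)
        then have "(real N + (M - 1 / 5)) / (M - 1 / 5) \<le> 4 * ((2 * real N + 1) * (M + 1)) / D"
          using D(1) M by (simp add: divide_le_eq le_divide_eq)
        then have "real N / (M - 1 / 5) + 1 \<le> 4 * ((2 * real N + 1) * (M + 1)) / D"
          using M by (simp add: add_divide_distrib)
        then show ?thesis
          using False 5(1,2) K KN by (intro epi_mono[OF epi_few_users]) (auto simp: D_def)
      qed
    qed (use M in auto)
  qed
qed

lemma gap_many_users:
  assumes M: "1 \<le> M" "M \<le> real N" and NK: "N \<le> K"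
  shows "ereal (R_ach N K M) \<le> ereal 5.4606 * R_opt N K q M"
proof -
  have e1: "epi N K 1 (real N - 1)"
    using epi_1[of N K] NK N by (simp add: min_absorb1 of_nat_diff)
  \<comment> \<open>Up to five files, and from M = N/2 on, s = 1 suffices; below N/2 the choice s =
    2 serves up to ten files. From eleven files on the rational bound even gives the factor
    5.4.\<close>
  consider "N \<le> 5" | "6 \<le> N" "real N / 2 \<le> M" | "6 \<le> N" "N \<le> 10" "M \<le> real N / 2"
    | "11 \<le> N" "M \<le> real N / 2" by linarith
  then show ?thesis
  proof cases
    case 1
    then have "N = 2 \<or> N = 3 \<or> N = 4 \<or> N = 5" using N by linarith
    then have "real N - 1 \<le> 5.4606 * (real 1 - 1 * cut_load N 1)" by (auto simp: cut_load_1)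
    then show ?thesis
      using M N K by (intro R_ach_le_cut[of 1 _ M 1 "real N"] epi_mono[OF e1] epi_mono[OF epi_N])
        (auto simp: cut_load_1)
  next
    case 2
    have e2: "epi N K (real N / 2) ((real N - 1) / (real N / 2 - 1) - 1)"
      using 2 NK by (intro epi_many_users) auto
    have "(real N - 1) / (real N / 2 - 1) - 1 \<le> 5.4606 * (real 1 - real N / 2 * cut_load N 1)"
      using 2 by (simp add: cut_load_1 divide_simps)
    then show ?thesis
      using 2 M N K by (intro R_ach_le_cut[of 1 _ M "real N / 2" "real N"] epi_mono[OF e2] epi_mono[OF epi_N])
        (auto simp: cut_load_1)
  next
    case 3
    then have cases: "N = 6 \<or> N = 7 \<or> N = 8 \<or> N = 9 \<or> N = 10" by linarith
    have e2: "epi N K (real N / 2) ((real N - 1) / (real N / 2 - 1) - 1)"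
      using 3 NK by (intro epi_many_users) auto
    have "real N - 1 \<le> 5.4606 * (real 2 - 1 * cut_load N 2)"
      unfolding cut_load_2 using cases by (elim disjE) simp_all
    moreover have "(real N - 1) / (real N / 2 - 1) - 1 \<le> 5.4606 * (real 2 - real N / 2 * cut_load N 2)"
      unfolding cut_load_2 using cases by (elim disjE) simp_all
    ultimately show ?thesis
      using 3 M N K by (intro R_ach_le_cut[of 2 _ M 1 "real N / 2"] epi_mono[OF e1] epi_mono[OF e2]) auto
  next
    case 4
    define D where "D = (2 * M + 3) * (2 * M + 1)"
    have "0 < D" unfolding D_def using M by (intro mult_pos_pos) auto
    moreover have "D = 4 * M\<^sup>2 + 8 * M + 3" by (simp add: D_def power2_eq_square algebra_simps)
    ultimately have D: "0 < D" "D = 4 * M\<^sup>2 + 8 * M + 3" by auto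
    define l where "l = (2 * real N + 1) * (M + 1) / D - 1 / 2"
    have x: "(2 * real N + 1) / (2 * M + 3) - 1 / 2 < real K"
    proof -
      define y where "y = (2 * real N + 1) / (2 * M + 3)"
      have "y \<le> (2 * real N + 1) / 3"
        unfolding y_def using M by (intro divide_left_mono) auto
      moreover have "real N \<le> real K" "11 \<le> real N" using NK 4 by auto
      ultimately show ?thesis unfolding y_def[symmetric] by (simp add: add_divide_distrib)
    qed
    have "epi N K M (5.4 * l)"
    proof (cases "M \<le> 5 / 2")
      case True
      \<comment> \<open>Slope of the chord from M = 1 to M = 5/2, which replaces (N - 1) / (M - 1) -
        1 near its pole at M = 1.\<close>
      define \<beta> where "\<beta> = 2 / 9 * real N + 4 / 9"
      have "epi N K (5 / 2) ((real N - 1) / (5 / 2 - 1) - 1)"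
        using 4 NK by (intro epi_many_users) auto
      moreover have "(real N - 1) / (5 / 2 - 1) - 1 = real N - 1 + \<beta> - \<beta> * (5 / 2)"
        by (simp add: \<beta>_def field_simps)
      ultimately have "epi N K (5 / 2) (real N - 1 + \<beta> - \<beta> * (5 / 2))"
        by (rule back_subst[where P = "epi N K (5 / 2)"])
      then have e: "epi N K M (real N - 1 + \<beta> - \<beta> * M)"
        using epi_line[of N K 1 "real N - 1 + \<beta>" \<beta> "5 / 2" M] e1 M True by simp
      have "0 \<le> (M - 2)\<^sup>2 * (M + 1 / 2)" using M by simp
      then have A: "0 \<le> 8 * M^3 - 28 * M\<^sup>2 + 15.2 * M + 64.2"
        using True by (simp add: power2_eq_square power3_eq_cube field_simps)
      \<comment> \<open>The double root 2 is near the minimiser of the cubic for N = 11. The linear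
        factor makes the quadratic terms agree after scaling by 104, leaving a linear remainder that
        is positive up to M = 5/2.\<close>
      have "0 \<le> (M - 2)\<^sup>2 * (M + (4 - 353.2 / 104))" using M by simp
      then have "0 \<le> 11 * (8 * M^3 - 28 * M\<^sup>2 + 15.2 * M + 64.2) + (16 * M^3 - 45.2 * M\<^sup>2 - 93.8 * M - 9.3)"
        using True by (simp add: power2_eq_square power3_eq_cube field_simps)
      then have "0 \<le> real N * (8 * M^3 - 28 * M\<^sup>2 + 15.2 * M + 64.2) + (16 * M^3 - 45.2 * M\<^sup>2 - 93.8 * M - 9.3)"
        by (rule affine_nonneg_mono[OF _ A]) (use 4 in simp)
      then have "(real N - 1 + \<beta> - \<beta> * M + 2.7) * D \<le> 5.4 * ((2 * real N + 1) * (M + 1))"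
        unfolding D(2) \<beta>_def by (simp add: power2_eq_square power3_eq_cube field_simps)
      then have "real N - 1 + \<beta> - \<beta> * M + 2.7 \<le> 5.4 * ((2 * real N + 1) * (M + 1)) / D"
        using D(1) by (simp add: le_divide_eq)
      also have "\<dots> = 5.4 * l + 2.7" by (simp add: l_def algebra_simps)
      finally show ?thesis by (intro epi_mono[OF e]) simp
    next
      case False
      \<comment> \<open>Clearing denominators turns the claim into
        \<open>?B \<le> real N * ?A\<close>; the 1.7 below is 5.4 / 2 - 1.\<close>
      let ?A = "6.8 * M\<^sup>2 - 8 * M - 13.8" and ?B = "6.8 * M^3 - 2.6 * M\<^sup>2 - 16.5 * M - 2.7"
      have A: "0 \<le> ?A"
      proof -
        have "0 \<le> (M - 5 / 2) * (6.8 * M + 9)" using False by simp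
        then show ?thesis by (simp add: power2_eq_square field_simps)
      qed
      have "?B \<le> real N * ?A"
      \<comment> \<open>Since N \<ge> 11, one has N \<ge> 3M up to M = 3; beyond that N \<ge> 2M
        suffices.\<close>
      proof (cases "M \<le> 3")
        case True
        have "0 \<le> (M - 5 / 2) * (13.6 * M\<^sup>2 + 12.6 * M + 6.6)" using False by simp
        then have "?B \<le> 3 * M * ?A"
          using False by (simp add: power2_eq_square power3_eq_cube field_simps)
        also have "\<dots> \<le> real N * ?A" using A True 4 by (intro mult_right_mono) auto
        finally show ?thesis .
      next
        case False
        then have "0 \<le> (M - 3) * (6.8 * M\<^sup>2 + 7 * M + 9.9)" by simp
        then have "?B \<le> 2 * M * ?A"
          using False by (simp add: power2_eq_square power3_eq_cube field_simps)
        also have "\<dots> \<le> real N * ?A" using A 4 by (intro mult_right_mono) auto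
        finally show ?thesis .
      qed
      then have "(real N - 1 + 1.7 * (M - 1)) * D \<le> 5.4 * ((2 * real N + 1) * (M + 1)) * (M - 1)"
        unfolding D(2) by (simp add: power2_eq_square power3_eq_cube field_simps)
      then have "(real N - 1 + 1.7 * (M - 1)) / (M - 1) \<le> 5.4 * ((2 * real N + 1) * (M + 1)) / D"
        using D(1) False by (simp add: divide_le_eq le_divide_eq)
      moreover have "(real N - 1 + 1.7 * (M - 1)) / (M - 1) = (real N - 1) / (M - 1) + 1.7"
      proof -
        have "M - 1 \<noteq> 0" using False by simp
        from nonzero_mult_div_cancel_right[OF this] show ?thesis by (simp only: add_divide_distrib)
      qed
      ultimately have "(real N - 1) / (M - 1) + 1.7 \<le> 5.4 * ((2 * real N + 1) * (M + 1)) / D"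
        by (rule ord_eq_le_trans[OF sym, rotated])
      also have "\<dots> = 5.4 * l + 2.7" by (simp add: l_def algebra_simps)
      finally have le: "(real N - 1) / (M - 1) - 1 \<le> 5.4 * l" by linarith
      show ?thesis
        using False 4 NK N by (intro epi_mono[OF epi_many_users le]) auto
    qed
    then have "ereal (R_ach N K M) \<le> ereal 5.4 * R_opt N K q M"
      using R_opt_ge_rational[OF _ M(2) x] M by (intro R_ach_le_mult) (auto simp: l_def D_def)
    also have "\<dots> \<le> ereal 5.4606 * R_opt N K q M"
      using R_opt_nonneg[of M] M by (intro ereal_mult_right_mono) auto
    finally show ?thesis .
  qed
qed

end

theorem theorem5:
  fixes N K q :: nat and M :: real
  assumes "N \<ge> 2" and "K \<ge> 2"
    and "\<exists>p k. prime p \<and> 0 < k \<and> q = p ^ k"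
    and "0 \<le> M" and "M \<le> real N"
  shows "(M \<le> 1 \<and> N \<ge> 2 * K \<longrightarrow> ereal (R_ach N K M) \<le> 2 * R_opt N K q M) \<and>
         (M \<le> 1/2 \<and> N < 2 * K \<longrightarrow> ereal (R_ach N K M) \<le> 2 * R_opt N K q M) \<and>
         (1/2 \<le> M \<and> M \<le> 1 \<and> N < 2 * K \<longrightarrow> ereal (R_ach N K M) \<le> 4 * R_opt N K q M) \<and>
         (1 \<le> M \<and> real N \<ge> real K * (real K + 1) / 2 \<longrightarrow>
            ereal (R_ach N K M) \<le> 4 * R_opt N K q M) \<and>
         (1 \<le> M \<and> K < N \<and> real N < real K * (real K + 1) / 2 \<longrightarrow>
            ereal (R_ach N K M) \<le> ereal 4.0177 * R_opt N K q M) \<and>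
         (1 \<le> M \<and> N \<le> K \<longrightarrow> ereal (R_ach N K M) \<le> ereal 5.4606 * R_opt N K q M)"
proof -
  obtain p k where pk: "prime p" "0 < k" "q = p ^ k" using assms(3) by blast
  have "2 \<le> p" using pk(1) by (rule prime_ge_2_nat)
  also have "p \<le> q" using pk prime_gt_0_nat[OF pk(1)] self_le_power[of p k] by simp
  finally interpret caching_params N K q using assms by unfold_locales auto
  have num: "ereal 2 = 2" "ereal 4 = 4" by (simp_all add: numeral_eq_ereal)
  have few: "ereal (R_ach N K M) \<le> ereal 4 * R_opt N K q M" if "1 \<le> M" "K < N"
    using gap_few_users[OF that(1) assms(5) that(2)] .
  have K_less: "K < N" if "real N \<ge> real K * (real K + 1) / 2"
  proof -
    have "real K * 3 \<le> real K * (real K + 1)" using K by (intro mult_left_mono) auto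
    then have "real K < real N" using that K by linarith
    then show ?thesis by simp
  qed
  have half: "real N \<le> 2 * (real N * (1 - M))" if "M \<le> 1 / 2"
    using mult_left_mono[OF that, of "real N"] by (simp add: algebra_simps)
  \<comment> \<open>The factor 4 holds for all N > K and is relaxed to 4.0177; this needs the
    optimal load to be nonnegative.\<close>
  have "ereal 4 * R_opt N K q M \<le> ereal 4.0177 * R_opt N K q M"
    using R_opt_nonneg[OF assms(4)] by (intro ereal_mult_right_mono) auto
  then show ?thesis
    using gap_small_cache_many_files[OF assms(4)] gap_tiny_cache[OF assms(4), of 2]
      gap_small_cache_few_files[of M] few gap_many_users[OF _ assms(5)] K_less half
    unfolding num by (meson order_trans order_refl)
qed

end
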